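(* Suppose $A,B$ are unital C*-algebras and $\theta:U^0(A)\to U^0(B)$ is a contractive injective group homomorphism such that $\theta(\mathbb{T})=\mathbb{T}$. Suppose that $T(A)\ne\emptyset$. Then there is a continuous affine map $T_\theta:T(B)\to T(A)$ such that $\Lambda_\theta(f)=f\circ T_\theta$ for all $f\in\operatorname{Aff}T(A)$, or $-\Lambda_\theta(f)=f\circ T_\theta$ for all $f\in\operatorname{Aff}T(A)$, depending on whether $\Lambda_\theta$ or $-\Lambda_\theta$ is positive.
   Context: For a unital C*-algebra $A$, $U^0(A)$ is the connected component of $1$ in the unitary group (norm topology); $\mathbb{T}$ is identified with $\mathbb{T}\cdot 1$. Contractive means $\|\theta(u)-\theta(v)\|\le\|u-v\|$ for all $u,v\in U^0(A)$. $T(A)$ is the set of tracial states (weak* topology), $\operatorname{Aff}T(A)$ the real Banach space (sup norm, pointwise order) of continuous affine functions $T(A)\to\mathbb{R}$ (zero if $T(A)=\emptyset$). For $a\in A_{sa}$ let $\hat a(\tau)=\tau(a)$, and $A_0=\{a\in A_{sa}:\tau(a)=0\ \forall\tau\in T(A)\}$; $[a]\mapsto\hat a$ is an isometric isomorphism $A_{sa}/A_0\cong\operatorname{Aff}T(A)$. A continuous group homomorphism $\theta$ determines a bounded $\mathbb{R}$-linear map $S_\theta:A_{sa}\to B_{sa}$ by $\theta(e^{2\pi i t a})=e^{2\pi i t S_\theta(a)}$ for all $t\in\mathbb{R}$. One has $S_\theta(A_0)\subseteq B_0$, and $\Lambda_\theta:\operatorname{Aff}T(A)\to\operatorname{Aff}T(B)$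 is the induced bounded $\mathbb{R}$-linear map $\Lambda_\theta(\hat a)=\widehat{S_\theta(a)}$. *)

theory Defs
  imports "HOL-Analysis.Analysis"
begin

text \<open>
  The axiom \<open>norm 1 = 1\<close> inherited from \<^class>\<open>real_normed_algebra_1\<close> only excludes
  the zero algebra. The topology of the type is the norm topology.
\<close>

class unital_cstar_algebra = real_normed_algebra_1 + banach +
  fixes scaleC :: "complex \<Rightarrow> 'a \<Rightarrow> 'a" (infixr \<open>*\<^sub>C\<close> 75)
    and adj :: "'a \<Rightarrow> 'a"
  assumes scaleC_add_right: "c *\<^sub>C (x + y) = c *\<^sub>C x + c *\<^sub>C y"
    and scaleC_add_left: "(c + d) *\<^sub>C x = c *\<^sub>C x + d *\<^sub>C x"
    and scaleC_scaleC: "c *\<^sub>C (d *\<^sub>C x) = (c * d) *\<^sub>C x"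
    and scaleC_of_real: "complex_of_real r *\<^sub>C x = r *\<^sub>R x"
    and mult_scaleC_left: "(c *\<^sub>C x) * y = c *\<^sub>C (x * y)"
    and mult_scaleC_right: "x * (c *\<^sub>C y) = c *\<^sub>C (x * y)"
    and norm_scaleC: "norm (c *\<^sub>C x) = cmod c * norm x"
    and adj_add: "adj (x + y) = adj x + adj y"
    and adj_scaleC: "adj (c *\<^sub>C x) = cnj c *\<^sub>C adj x"
    and adj_mult: "adj (x * y) = adj y * adj x"
    and adj_adj: "adj (adj x) = x"
    and cstar_identity: "norm (adj x * x) = (norm x)\<^sup>2"

instantiation complex :: unital_cstar_algebra
begin

definition scaleC_complex :: "complex \<Rightarrow> complex \<Rightarrow> complex" where
  "scaleC_complex c x = c * x"

definition adj_complex :: "complex \<Rightarrow> complex" where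
  "adj_complex = cnj"

instance
  by standard
    (simp_all add: scaleC_complex_def adj_complex_def algebra_simps norm_mult
      scaleR_conv_of_real power2_eq_square)

end

definition unitaries :: "'a::unital_cstar_algebra set" where
  "unitaries = {u. adj u * u = 1 \<and> u * adj u = 1}"

definition U0 :: "'a::unital_cstar_algebra set" where
  "U0 = connected_component_set unitaries 1"

definition scalar_circle :: "'a::unital_cstar_algebra set" where
  "scalar_circle = (\<lambda>z. z *\<^sub>C 1) ` {z. cmod z = 1}"

definition self_adjoint :: "'a::unital_cstar_algebra set" where
  "self_adjoint = {a. adj a = a}"

definition tracial_states :: "('a::unital_cstar_algebra \<Rightarrow> complex) set" where
  "tracial_states = {\<tau>.
     (\<forall>x y. \<tau> (x + y) = \<tau> x + \<tau> y) \<and>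
     (\<forall>c x. \<tau> (c *\<^sub>C x) = c * \<tau> x) \<and>
     (\<forall>x. \<tau> (adj x * x) \<in> \<real>\<^sub>\<ge>\<^sub>0) \<and>
     \<tau> 1 = 1 \<and>
     (\<forall>x y. \<tau> (x * y) = \<tau> (y * x))}"

text \<open>
  The function type \<open>'a \<Rightarrow> complex\<close> carries the topology of pointwise convergence, so
  \<open>continuous_on\<close> and related notions for \<^const>\<open>tracial_states\<close> refer to the weak* topology.
\<close>

definition convex_comb :: "real \<Rightarrow> ('a \<Rightarrow> complex) \<Rightarrow> ('a \<Rightarrow> complex) \<Rightarrow> 'a \<Rightarrow> complex" where
  "convex_comb s \<sigma> \<tau> = (\<lambda>a. complex_of_real (1 - s) * \<sigma> a + complex_of_real s * \<tau> a)"

text \<open>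
  A function on the tracial state space is represented by its extension by zero to the whole
  type. If there are no tracial states, \<open>AffT\<close> contains only the zero function.
\<close>

definition AffT :: "(('a::unital_cstar_algebra \<Rightarrow> complex) \<Rightarrow> real) set" where
  "AffT = {f.
     continuous_on tracial_states f \<and>
     (\<forall>\<sigma>\<in>tracial_states. \<forall>\<tau>\<in>tracial_states. \<forall>s\<in>{0..1}.
        f (convex_comb s \<sigma> \<tau>) = (1 - s) * f \<sigma> + s * f \<tau>) \<and>
     (\<forall>\<tau>. \<tau> \<notin> tracial_states \<longrightarrow> f \<tau> = 0)}"

definition AffT_norm :: "(('a::unital_cstar_algebra \<Rightarrow> complex) \<Rightarrow> real) \<Rightarrow> real" where
  "AffT_norm f = (SUP \<tau>. \<bar>f \<tau>\<bar>)"

text \<open>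
  The values of a tracial state on self-adjoint elements are real, so \<open>Re\<close> is only a coercion.
\<close>

definition hat :: "'a::unital_cstar_algebra \<Rightarrow> ('a \<Rightarrow> complex) \<Rightarrow> real" where
  "hat a = (\<lambda>\<tau>. if \<tau> \<in> tracial_states then Re (\<tau> a) else 0)"

definition S_map ::
  "('a::unital_cstar_algebra \<Rightarrow> 'b::unital_cstar_algebra) \<Rightarrow> 'a \<Rightarrow> 'b" where
  "S_map \<theta> a = (THE b. b \<in> self_adjoint \<and>
     (\<forall>t::real. \<theta> (exp ((2 * pi * \<i> * t) *\<^sub>C a)) = exp ((2 * pi * \<i> * t) *\<^sub>C b)))"

definition bounded_linear_AffT ::
  "((('a::unital_cstar_algebra \<Rightarrow> complex) \<Rightarrow> real) \<Rightarrow>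
    (('b::unital_cstar_algebra \<Rightarrow> complex) \<Rightarrow> real)) \<Rightarrow> bool" where
  "bounded_linear_AffT L \<longleftrightarrow>
     L ` AffT \<subseteq> AffT \<and>
     (\<forall>f\<in>AffT. \<forall>g\<in>AffT. L (\<lambda>\<tau>. f \<tau> + g \<tau>) = (\<lambda>\<tau>. L f \<tau> + L g \<tau>)) \<and>
     (\<forall>r. \<forall>f\<in>AffT. L (\<lambda>\<tau>. r * f \<tau>) = (\<lambda>\<tau>. r * L f \<tau>)) \<and>
     (\<exists>K. \<forall>f\<in>AffT. AffT_norm (L f) \<le> K * AffT_norm f)"

text \<open>
  The value zero off \<^const>\<open>AffT\<close> is a convention that makes the description unique.
\<close>

definition Lambda_map ::
  "('a::unital_cstar_algebra \<Rightarrow> 'b::unital_cstar_algebra) \<Rightarrow>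
    (('a \<Rightarrow> complex) \<Rightarrow> real) \<Rightarrow> (('b \<Rightarrow> complex) \<Rightarrow> real)" where
  "Lambda_map \<theta> = (THE L. bounded_linear_AffT L \<and>
     (\<forall>a\<in>self_adjoint. L (hat a) = hat (S_map \<theta> a)) \<and>
     (\<forall>f. f \<notin> AffT \<longrightarrow> L f = (\<lambda>_. 0)))"

definition positive_AffT ::
  "((('a::unital_cstar_algebra \<Rightarrow> complex) \<Rightarrow> real) \<Rightarrow>
    (('b::unital_cstar_algebra \<Rightarrow> complex) \<Rightarrow> real)) \<Rightarrow> bool" where
  "positive_AffT L \<longleftrightarrow>
     (\<forall>f\<in>AffT. (\<forall>\<tau>\<in>tracial_states. 0 \<le> f \<tau>) \<longrightarrow> (\<forall>\<tau>\<in>tracial_states. 0 \<le> L f \<tau>))"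

definition affine_map_T ::
  "(('b::unital_cstar_algebra \<Rightarrow> complex) \<Rightarrow> ('a::unital_cstar_algebra \<Rightarrow> complex)) \<Rightarrow> bool" where
  "affine_map_T F \<longleftrightarrow>
     (\<forall>\<sigma>\<in>tracial_states. \<forall>\<tau>\<in>tracial_states. \<forall>s\<in>{0..1}.
        F (convex_comb s \<sigma> \<tau>) = convex_comb s (F \<sigma>) (F \<tau>))"

end

theory Submission
  imports Defs
begin

text \<open>
  Differentiating \<open>\<theta>\<close> along one-parameter groups gives \<open>S = S_map \<theta>\<close>. Contractivity makes the derivative
  of \<open>\<theta> \<circ> \<gamma>\<close> at \<open>0\<close> depend only on that of \<open>\<gamma>\<close>, which yields at once that \<open>S\<close> is additive,
  contractive and intertwines conjugation by \<open>u\<close> with conjugation by \<open>\<theta> u\<close>. The condition on the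
  circle forces \<open>S 1 = s \<cdot> 1\<close> with \<open>s = 1\<close> or \<open>s = -1\<close>. For a tracial state \<open>\<tau>\<close> on the codomain,
  \<open>s \<tau> \<circ> S\<close> is therefore unital and contractive, and invariant under conjugation, hence tracial. A unital
  contractive functional is nonnegative on squares of self-adjoint elements, and for a tracial
  functional this suffices for positivity. So \<open>T \<tau> = s \<tau> \<circ> S\<close> maps tracial states to tracial states,
  and \<open>f \<mapsto> s (f \<circ> T)\<close> has the defining property of \<open>\<Lambda>\<close>. It is the only such map because the
  functions \<open>hat a\<close> are uniformly dense in the continuous affine functions.
\<close>

section \<open>Banach algebras\<close>

text \<open>The geometric series in \<open>1 - x\<close> converges absolutely, and its partial sums
  telescope against \<open>x\<close>.\<close>

lemma neumann_right_inverse: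
  fixes x :: "'a::{real_normed_algebra_1,banach}"
  assumes "norm (1 - x) < 1"
  obtains y where "x * y = 1"
proof -
  define r where "r = 1 - x"
  have r: "norm r < 1" using assms by (simp add: r_def)
  have sm: "summable (\<lambda>n. r ^ n)"
    by (rule summable_norm_cancel, rule summable_comparison_test'[of "\<lambda>n. norm r ^ n" 0])
       (use r in \<open>auto intro: summable_geometric simp: norm_power_ineq\<close>)
  have "x * (\<Sum>n<k. r ^ n) = 1 - r ^ k" for k
    by (induction k) (simp_all add: r_def algebra_simps)
  moreover have "(\<lambda>k. x * (\<Sum>n<k. r ^ n)) \<longlonglongrightarrow> x * (\<Sum>n. r ^ n)"
    by (intro tendsto_intros summable_LIMSEQ sm)
  moreover have "(\<lambda>k. 1 - r ^ k) \<longlonglongrightarrow> 1 - 0"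
    by (intro tendsto_intros summable_LIMSEQ_zero sm)
  ultimately have "x * (\<Sum>n. r ^ n) = 1"
    using LIMSEQ_unique by force
  then show thesis by (rule that)
qed

text \<open>Averaging a one-parameter group over a short interval gives an invertible element, and
  multiplying by its inverse exhibits the group as a difference of primitives.\<close>

lemma one_parameter_group_eq_exp:
  fixes u :: "real \<Rightarrow> 'a::{real_normed_algebra_1,banach}"
  assumes u0: "u 0 = 1" and add: "\<And>s t. u (s + t) = u s * u t" and cont: "continuous_on UNIV u"
  obtains c where "\<And>t. u t = exp (t *\<^sub>R c)"
proof -
  have int: "u integrable_on {a..b}" for a b
    by (intro integrable_continuous_real continuous_on_subset[OF cont]) auto
  obtain d where d: "d > 0" "\<And>s. \<bar>s\<bar> < d \<Longrightarrow> norm (u s - 1) < 1/2"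
    using cont[unfolded continuous_on_iff, rule_format, of 0 "1/2"] u0
    by (auto simp: dist_norm)
  \<comment> \<open>Halving \<open>d\<close> puts the closed interval \<open>{0..e}\<close> inside
    the range where \<open>u\<close> stays within 1/2 of 1, so the mean of \<open>u\<close> over it
    is within 1/2 of 1.\<close>
  define e where "e = d / 2"
  have e: "e > 0" "\<And>s. s \<in> {0..e} \<Longrightarrow> norm (u s - 1) \<le> 1/2"
    using d by (auto simp: e_def intro!: less_imp_le)
  define m where "m = integral {0..e} u"
  have "m - e *\<^sub>R 1 = integral {0..e} (\<lambda>s. u s - 1)"
    unfolding m_def using e(1) by (subst integral_diff) (auto intro: int)
  moreover have "norm (integral {0..e} (\<lambda>s. u s - 1)) \<le> 1/2 * (e - 0)"
    by (rule integral_bound)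
       (use e in \<open>auto intro!: continuous_intros continuous_on_subset[OF cont]\<close>)
  ultimately have m: "norm (m - e *\<^sub>R 1) \<le> e / 2" by simp
  have "1 - (1/e) *\<^sub>R m = - ((1/e) *\<^sub>R (m - e *\<^sub>R 1))"
    using e(1) by (simp add: scaleR_diff_right)
  then have "norm (1 - (1/e) *\<^sub>R m) = (1/e) * norm (m - e *\<^sub>R 1)"
    using e(1) by simp
  also have "\<dots> < 1" using m e(1) by (simp add: field_simps)
  finally obtain y where y: "(1/e) *\<^sub>R m * y = 1"
    using neumann_right_inverse by blast
  define z where "z = (1/e) *\<^sub>R y"
  have z: "m * z = 1" using y by (simp add: z_def)
  \<comment> \<open>The base point -1 makes \<open>G\<close> differentiable on both sides of 0,
    where the derivative of \<open>u\<close> is to be computed.\<close>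
  define G where "G t = integral {-1..t} u" for t
  have G: "(G has_vector_derivative u t) (at t)" if "t > -1" for t
  proof -
    have "(G has_vector_derivative u t) (at t within {-1..t+1})"
      unfolding G_def
      by (rule integral_has_vector_derivative) (use that in \<open>auto intro: continuous_on_subset[OF cont]\<close>)
    then have "(G has_vector_derivative u t) (at t within {-1<..<t+1})"
      by (rule has_vector_derivative_within_subset) auto
    then show ?thesis
      using that by (subst (asm) has_vector_derivative_within_open) auto
  qed
  \<comment> \<open>Multiplication by \<open>u t\<close> shifts the interval of integration by
    \<open>t\<close>. Cancelling \<open>m\<close> with \<open>z\<close> then shows that
    \<open>u\<close> is differentiable at 0.\<close>
  have um: "u t * m = G (t + e) - G t" if "t > -1" for t
  proof -
    have "u t * m = integral {0..e} (\<lambda>s. u t * u s)"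
      unfolding m_def
      using integral_linear[OF int bounded_linear_mult_right, of 0 e "u t"] by (simp add: o_def)
    also have "\<dots> = integral {0..e} (u \<circ> ((+) t))"
      by (simp add: o_def add)
    also have "\<dots> = integral {t..t+e} u"
      by (subst integral_shift_Icc_real) (simp add: add.commute)
    also have "\<dots> = G (t + e) - G t"
      using Henstock_Kurzweil_Integration.integral_combine[of "-1" t "t + e" u] that e(1) int
      by (simp add: G_def algebra_simps)
    finally show ?thesis .
  qed
  define c where "c = (u e - u 0) * z"
  have shift: "((\<lambda>t. t + r) has_vector_derivative 1) (at t)" for r t :: real
    by (auto intro!: derivative_eq_intros)
  have "((\<lambda>t. G (t + e)) has_vector_derivative u e) (at 0)"
    using vector_diff_chain_at[OF shift[of e 0], where g = G and g' = "u e"] G[of e] e(1) by (simp add: o_def)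
  then have "((\<lambda>t. (G (t + e) - G t) * z) has_vector_derivative c) (at 0)"
    using G[of 0] unfolding c_def
    by (intro has_vector_derivative_mult_left has_vector_derivative_diff) auto
  then have u'0: "(u has_vector_derivative c) (at 0)"
  proof (rule has_vector_derivative_transform_within_open[where S = "{-1<..}"])
    fix t :: real assume "t \<in> {-1<..}"
    then show "(G (t + e) - G t) * z = u t"
      using um[of t] z by (metis greaterThan_iff mult.assoc mult.right_neutral)
  qed auto
  have u': "(u has_vector_derivative u t * c) (at t)" for t
  proof -
    have "((\<lambda>s. u t * u (s - t)) has_vector_derivative u t * c) (at t)"
      using vector_diff_chain_at[OF shift[of "- t" t], where g = u and g' = c] u'0
      by (auto simp: o_def intro: has_vector_derivative_mult_right)
    moreover have "u t * u (s - t) = u s" for s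
      by (simp flip: add)
    ultimately show ?thesis by simp
  qed
  \<comment> \<open>The quotient of \<open>u\<close> by the expected exponential has derivative
    zero, hence keeps its value 1 at 0.\<close>
  define w where "w t = u t * exp (t *\<^sub>R (- c))" for t
  have "(w has_vector_derivative 0) (at t within UNIV)" for t
    using has_vector_derivative_mult[OF u'[of t] exp_scaleR_has_vector_derivative_left[of "- c" t]]
    unfolding w_def by (simp add: mult.assoc)
  then obtain k where k: "\<And>t. w t = k"
    using has_vector_derivative_zero_constant[of UNIV w] by auto
  have "w t = 1" for t using k[of t] k[of 0] by (simp add: w_def u0)
  then have "u t = exp (t *\<^sub>R c)" for t
    using exp_minus_inverse[of "- (t *\<^sub>R c)"] unfolding w_def
    by (metis minus_minus mult.assoc mult.left_neutral mult.right_neutral scaleR_minus_right)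
  then show thesis by (rule that)
qed

text \<open>The generator is the derivative of the group at 0.\<close>

lemma exp_scaleR_inject:
  fixes b c :: "'a::{real_normed_algebra_1,banach}"
  assumes "\<And>t::real. exp (t *\<^sub>R b) = exp (t *\<^sub>R c)"
  shows "b = c"
  using exp_scaleR_has_vector_derivative_right[of b 0 UNIV]
    exp_scaleR_has_vector_derivative_right[of c 0 UNIV] assms
  by (simp add: vector_derivative_unique_at)

section \<open>Square roots by the binomial series\<close>

lemma abs_summable_gbinomial_half_power:
  fixes a :: "'a::{real_normed_algebra_1,banach}"
  assumes "norm a < 1"
  shows "summable (\<lambda>n. norm (((1/2::real) gchoose n) *\<^sub>R a ^ n))"
proof (rule summable_comparison_test')
  have "ereal (norm (norm a)) < conv_radius (\<lambda>n. (1/2::real) gchoose n)"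
    using assms by (auto simp: conv_radius_gchoose)
  from abs_summable_in_conv_radius[OF this]
  show "summable (\<lambda>n. norm (((1/2::real) gchoose n) * norm a ^ n))" .
qed (auto simp: norm_power_ineq abs_mult intro!: mult_left_mono)

text \<open>By Vandermonde's identity, the Cauchy product of the series for exponent 1/2 with itself
  is the series for exponent 1, which stops after the linear term.\<close>

lemma gbinomial_half_series_square:
  fixes a :: "'a::{real_normed_algebra_1,banach}"
  assumes "norm a < 1"
  defines "y \<equiv> \<Sum>n. ((1/2::real) gchoose n) *\<^sub>R a ^ n"
  shows "y * y = 1 + a"
proof -
  let ?c = "\<lambda>n. (1/2::real) gchoose n"
  have "(\<lambda>k. \<Sum>i\<le>k. (?c i *\<^sub>R a ^ i) * (?c (k - i) *\<^sub>R a ^ (k - i))) sums (y * y)"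
    unfolding y_def
    by (rule Cauchy_product_sums) (rule abs_summable_gbinomial_half_power[OF assms(1)])+
  also have "(\<lambda>k. \<Sum>i\<le>k. (?c i *\<^sub>R a ^ i) * (?c (k - i) *\<^sub>R a ^ (k - i)))
      = (\<lambda>k. (1 gchoose k) *\<^sub>R a ^ k)"
  proof
    fix k
    have "(\<Sum>i\<le>k. (?c i *\<^sub>R a ^ i) * (?c (k - i) *\<^sub>R a ^ (k - i)))
        = (\<Sum>i\<le>k. (?c i * ?c (k - i)) *\<^sub>R a ^ k)"
      by (intro sum.cong) (auto simp: mult.commute simp flip: power_add)
    also have "\<dots> = (1 gchoose k) *\<^sub>R a ^ k"
      using gbinomial_Vandermonde[of "1/2::real" "1/2" k]
      by (simp flip: scaleR_sum_left add: atLeast0AtMost)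
    finally show "(\<Sum>i\<le>k. (?c i *\<^sub>R a ^ i) * (?c (k - i) *\<^sub>R a ^ (k - i)))
        = (1 gchoose k) *\<^sub>R a ^ k" .
  qed
  finally have "(\<lambda>k. (1 gchoose k) *\<^sub>R a ^ k) sums (y * y)" .
  moreover have "(1::real) gchoose k = 0" if "k \<notin> {0, 1}" for k
    using that binomial_gbinomial[of 1 k, where 'a = real] by (simp add: binomial_eq_0)
  then have "(\<lambda>k. ((1::real) gchoose k) *\<^sub>R a ^ k) sums (\<Sum>k\<in>{0,1}. ((1::real) gchoose k) *\<^sub>R a ^ k)"
    by (intro sums_finite) auto
  ultimately show ?thesis
    using sums_unique2 by fastforce
qed

text \<open>A positive second derivative would make \<open>g'\<close> positive just to the right of
  0, and \<open>g\<close> would rise above \<open>g 0\<close> there.\<close>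

lemma second_derivative_nonpos_at_max:
  fixes g :: "real \<Rightarrow> real"
  assumes g: "\<And>t. (g has_real_derivative g' t) (at t)"
    and g': "(g' has_real_derivative k) (at 0)"
    and "g' 0 = 0" and max: "\<And>t. g t \<le> g 0"
  shows "k \<le> 0"
proof (rule ccontr)
  assume "\<not> k \<le> 0"
  then obtain d where d: "d > 0" "\<And>h. 0 < h \<Longrightarrow> h < d \<Longrightarrow> g' 0 < g' h"
    using DERIV_pos_inc_right[OF g'] by auto
  have "g 0 < g (d/2)"
  proof (rule DERIV_pos_imp_increasing_open[of 0 "d/2" g])
    show "\<exists>y. (g has_real_derivative y) (at x) \<and> 0 < y" if "0 < x" "x < d/2" for x
      using g[of x] d(2)[of x] that d(1) \<open>g' 0 = 0\<close> by auto
    show "continuous_on {0..d/2} g"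
      by (meson DERIV_continuous_on g has_field_derivative_at_within)
  qed (use d in simp)
  with max[of "d/2"] show False by simp
qed


section \<open>Unital C*-algebras\<close>

lemma scaleC_one [simp]: "1 *\<^sub>C x = x"
  using scaleC_of_real[of 1 x] by simp

lemma scaleC_zero_left [simp]: "0 *\<^sub>C x = 0"
  using scaleC_of_real[of 0 x] by simp

lemma scaleC_minus_left: "(- c) *\<^sub>C x = - (c *\<^sub>C x)"
  using scaleC_add_left[of "- c" c x] by (simp add: eq_neg_iff_add_eq_0)

lemma scaleC_diff_left: "(c - d) *\<^sub>C x = c *\<^sub>C x - d *\<^sub>C x"
  using scaleC_add_left[of c "- d" x] by (simp add: scaleC_minus_left)

lemma scaleC_zero_right [simp]: "c *\<^sub>C 0 = 0"
  using scaleC_add_right[of c 0 0] by simp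

lemma scaleC_minus_right: "c *\<^sub>C (- x) = - (c *\<^sub>C x)"
  using scaleC_add_right[of c "- x" x] by (simp add: eq_neg_iff_add_eq_0)

lemma scaleC_diff_right: "c *\<^sub>C (x - y) = c *\<^sub>C x - c *\<^sub>C y"
  using scaleC_add_right[of c x "- y"] by (simp add: scaleC_minus_right)

lemma scaleC_scaleR: "c *\<^sub>C (r *\<^sub>R x) = r *\<^sub>R (c *\<^sub>C x)"
  by (simp add: scaleC_scaleC mult.commute flip: scaleC_of_real)

lemma scaleR_scaleC: "r *\<^sub>R (c *\<^sub>C x) = (of_real r * c) *\<^sub>C x"
  by (simp add: scaleC_scaleC flip: scaleC_of_real)

lemma adj_scaleR: "adj (r *\<^sub>R x) = r *\<^sub>R adj x"
  by (simp add: adj_scaleC flip: scaleC_of_real)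

lemma adj_zero [simp]: "adj 0 = 0"
  using adj_scaleR[of 0 0] by simp

lemma adj_minus: "adj (- x) = - adj x"
  using adj_scaleR[of "- 1" x] by simp

lemma adj_diff: "adj (x - y) = adj x - adj y"
  using adj_add[of x "- y"] by (simp add: adj_minus)

lemma adj_one [simp]: "adj 1 = 1"
  by (metis adj_adj adj_mult mult_1_left mult_1_right)

lemma adj_power: "adj (x ^ n) = adj x ^ n"
  by (induction n) (simp_all add: adj_mult power_commutes)

text \<open>The C*-identity and submultiplicativity give one inequality; applied to
  \<open>adj x\<close> it gives the other.\<close>

lemma norm_adj [simp]: "norm (adj x) = norm x"
proof -
  have le: "norm x \<le> norm (adj x)" for x
  proof (cases "norm x = 0")
    case False
    have "norm x * norm x \<le> norm (adj x) * norm x"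
      using cstar_identity[of x] norm_mult_ineq[of "adj x" x] by (simp add: power2_eq_square)
    with False show ?thesis
      using mult_le_cancel_right[of "norm x" "norm x" "norm (adj x)"] norm_ge_zero[of x] by auto
  qed simp
  show ?thesis using le[of x] le[of "adj x"] by (simp add: adj_adj)
qed

lemma bounded_linear_adj: "bounded_linear (adj :: 'a::unital_cstar_algebra \<Rightarrow> 'a)"
  by (rule bounded_linear_intro[of _ 1]) (auto simp: adj_add adj_scaleR)

lemma bounded_linear_scaleC: "bounded_linear (\<lambda>x::'a::unital_cstar_algebra. c *\<^sub>C x)"
  by (rule bounded_linear_intro[of _ "cmod c"])
     (auto simp: scaleC_add_right scaleC_scaleR norm_scaleC mult.commute)

lemma bounded_linear_scaleC_one: "bounded_linear (\<lambda>z. z *\<^sub>C (1::'a::unital_cstar_algebra))"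
  by (rule bounded_linear_intro[of _ 1])
     (auto simp: scaleC_add_left norm_scaleC scaleR_scaleC scaleR_conv_of_real[where 'a = complex])

lemma norm_scaleC_one [simp]: "norm (z *\<^sub>C (1::'a::unital_cstar_algebra)) = cmod z"
  by (simp add: norm_scaleC)

lemma scaleC_one_inject [simp]: "z *\<^sub>C (1::'a::unital_cstar_algebra) = w *\<^sub>C 1 \<longleftrightarrow> z = w"
  using norm_scaleC_one[of "z - w", where 'a = 'a] by (auto simp: scaleC_diff_left)

lemma adj_exp: "adj (exp x) = exp (adj (x::'a::unital_cstar_algebra))"
proof -
  have "adj (\<Sum>n. x ^ n /\<^sub>R fact n) = (\<Sum>n. adj (x ^ n /\<^sub>R fact n))"
    by (rule bounded_linear.suminf[OF bounded_linear_adj summable_exp_generic])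
  then show ?thesis
    by (simp add: exp_def adj_scaleR adj_power)
qed

lemma exp_scaleC_one: "exp (z *\<^sub>C (1::'a::unital_cstar_algebra)) = exp z *\<^sub>C 1"
proof -
  have pow: "(z *\<^sub>C (1::'a)) ^ n = z ^ n *\<^sub>C 1" for n
    by (induction n) (simp_all add: mult_scaleC_left scaleC_scaleC)
  have "(\<Sum>n. z ^ n /\<^sub>R fact n) *\<^sub>C (1::'a) = (\<Sum>n. (z ^ n /\<^sub>R fact n) *\<^sub>C 1)"
    by (rule bounded_linear.suminf[OF bounded_linear_scaleC_one summable_exp_generic])
  then show ?thesis
    by (simp add: exp_def pow scaleR_scaleC scaleR_conv_of_real[where 'a = complex])
qed

section \<open>Real and imaginary parts\<close>

definition re_part :: "'a::unital_cstar_algebra \<Rightarrow> 'a" where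
  "re_part x = (1/2) *\<^sub>R (x + adj x)"

definition im_part :: "'a::unital_cstar_algebra \<Rightarrow> 'a" where
  "im_part x = (- \<i> / 2) *\<^sub>C (x - adj x)"

lemma re_im_part: "re_part x + \<i> *\<^sub>C im_part x = x"
proof -
  have "(- \<i> / 2) *\<^sub>C (x - adj x) = (1/2) *\<^sub>R ((- \<i>) *\<^sub>C (x - adj x))"
    by (simp add: scaleR_scaleC)
  then have "\<i> *\<^sub>C im_part x = (1/2) *\<^sub>R (x - adj x)"
    by (simp add: im_part_def scaleC_scaleR scaleC_scaleC)
  moreover have "(1/2) *\<^sub>R x + (1/2) *\<^sub>R x = x"
    by (simp flip: scaleR_add_left)
  ultimately show ?thesis
    by (simp add: re_part_def scaleR_add_right scaleR_diff_right)
qed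

lemma adj_re_part [simp]: "adj (re_part x) = re_part x"
  by (simp add: re_part_def adj_scaleR adj_add adj_adj add.commute)

lemma adj_im_part [simp]: "adj (im_part x) = im_part x"
proof -
  have "adj (im_part x) = (\<i> / 2) *\<^sub>C (- (x - adj x))"
    by (simp add: im_part_def adj_scaleC adj_diff adj_adj)
  also have "\<dots> = im_part x"
    unfolding im_part_def by (simp only: scaleC_minus_right scaleC_minus_left flip: minus_divide_left)
  finally show ?thesis .
qed

lemma re_part_add: "re_part (x + y) = re_part x + re_part y"
  by (simp add: re_part_def adj_add algebra_simps)

lemma im_part_add: "im_part (x + y) = im_part x + im_part y"
  by (simp add: im_part_def adj_add add_diff_add flip: scaleC_add_right)

lemma re_part_scaleR: "re_part (r *\<^sub>R x) = r *\<^sub>R re_part x"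
  by (simp add: re_part_def adj_scaleR algebra_simps)

lemma im_part_scaleR: "im_part (r *\<^sub>R x) = r *\<^sub>R im_part x"
  by (simp add: im_part_def adj_scaleR scaleC_scaleR flip: scaleR_diff_right)

lemma re_part_scaleC_i: "re_part (\<i> *\<^sub>C x) = - im_part x"
  unfolding im_part_def re_part_def
  by (simp add: adj_scaleC scaleC_minus_left scaleC_diff_right scaleR_diff_right scaleR_scaleC)

lemma im_part_scaleC_i: "im_part (\<i> *\<^sub>C x) = re_part x"
proof -
  have "im_part (\<i> *\<^sub>C x) = complex_of_real (1/2) *\<^sub>C x + complex_of_real (1/2) *\<^sub>C adj x"
    by (simp add: im_part_def adj_scaleC scaleC_minus_left scaleC_add_right scaleC_scaleC)
  then show ?thesis
    by (simp only: scaleC_of_real re_part_def scaleR_add_right)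
qed

lemma re_part_self_adjoint: "adj a = a \<Longrightarrow> re_part a = a"
  by (simp add: re_part_def flip: scaleR_2)

lemma im_part_self_adjoint: "adj a = a \<Longrightarrow> im_part a = 0"
  by (simp add: im_part_def)

lemma norm_re_part_le: "norm (re_part x) \<le> norm x"
  using norm_triangle_ineq[of x "adj x"] by (simp add: re_part_def)

lemma norm_im_part_le: "norm (im_part x) \<le> norm x"
  using norm_triangle_ineq4[of x "adj x"] by (simp add: im_part_def norm_scaleC norm_divide)

subsection \<open>Unitaries\<close>

lemma norm_unitary: "u \<in> unitaries \<Longrightarrow> norm u = 1"
  using cstar_identity[of u] by (auto simp: unitaries_def power2_eq_1_iff)
    (metis norm_ge_zero not_one_le_zero neg_0_le_iff_le)

lemma unitary_mult: "u \<in> unitaries \<Longrightarrow> v \<in> unitaries \<Longrightarrow> u * v \<in> unitaries"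
  unfolding unitaries_def by (simp add: adj_mult) (metis mult.assoc mult_1_left)

lemma exp_skew_unitary:
  assumes "adj c = - (c::'a::unital_cstar_algebra)"
  shows "exp c \<in> unitaries"
  using exp_minus_inverse[of c] exp_minus_inverse[of "- c"] assms
  by (simp add: unitaries_def adj_exp)

lemma one_in_U0: "1 \<in> U0"
  by (simp add: U0_def unitaries_def)

lemma U0_subset_unitaries: "U0 \<subseteq> unitaries"
  by (simp add: U0_def connected_component_subset)

text \<open>Left translation by \<open>u\<close> turns the component of 1 into a connected set of
  unitaries containing \<open>u\<close> and \<open>u * v\<close>, so \<open>u * v\<close> lies in
  the component of \<open>u\<close>, which is that of 1.\<close>

lemma U0_mult:
  fixes u v :: "'a::unital_cstar_algebra"
  assumes "u \<in> U0" "v \<in> U0" shows "u * v \<in> U0"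
proof -
  have u: "u \<in> unitaries" using assms(1) U0_subset_unitaries by auto
  have "connected ((*) u ` U0)"
    unfolding U0_def
    by (intro connected_continuous_image continuous_intros connected_connected_component)
  moreover have "(*) u ` U0 \<subseteq> unitaries"
    using u U0_subset_unitaries unitary_mult by blast
  moreover have "u * 1 \<in> (*) u ` U0" "u * v \<in> (*) u ` U0"
    using assms one_in_U0 by blast+
  ultimately have "connected_component unitaries u (u * v)"
    unfolding connected_component_def by force
  then show ?thesis
    using assms(1) unfolding U0_def by (auto intro: connected_component_trans)
qed

text \<open>The path \<open>exp (t *\<^sub>R c)\<close> for \<open>t\<close> from 0 to 1 consists of
  unitaries and joins 1 to \<open>exp c\<close>.\<close>

lemma exp_skew_in_U0:
  assumes "adj c = - (c::'a::unital_cstar_algebra)"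
  shows "exp c \<in> U0"
proof -
  have "connected ((\<lambda>t. exp (t *\<^sub>R c)) ` {0..1::real})"
    by (intro connected_continuous_image connected_Icc
        continuous_on_vector_derivative[OF exp_scaleR_has_vector_derivative_right])
  moreover have "(\<lambda>t. exp (t *\<^sub>R c)) ` {0..1::real} \<subseteq> unitaries"
    using assms by (auto intro!: exp_skew_unitary simp: adj_scaleR)
  moreover have "exp (0 *\<^sub>R c) \<in> (\<lambda>t. exp (t *\<^sub>R c)) ` {0..1::real}"
    "exp (1 *\<^sub>R c) \<in> (\<lambda>t. exp (t *\<^sub>R c)) ` {0..1::real}"
    by (auto intro!: imageI simp del: scaleR_one scaleR_zero_left exp_zero)
  ultimately have "connected_component unitaries 1 (exp c)"
    unfolding connected_component_def by (intro exI[of _ "(\<lambda>t. exp (t *\<^sub>R c)) ` {0..1::real}"]) simp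
  then show ?thesis by (simp add: U0_def)
qed

subsection \<open>Tracial states\<close>

lemma tracial_stateD:
  assumes "\<tau> \<in> tracial_states"
  shows "\<tau> (x + y) = \<tau> x + \<tau> y" "\<tau> (c *\<^sub>C x) = c * \<tau> x" "\<tau> (adj x * x) \<in> \<real>\<^sub>\<ge>\<^sub>0" "\<tau> 1 = 1"
    "\<tau> (x * y) = \<tau> (y * x)"
  using assms by (auto simp: tracial_states_def)

lemma tracial_state_scaleR: "\<tau> \<in> tracial_states \<Longrightarrow> \<tau> (r *\<^sub>R x) = of_real r * \<tau> x"
  by (simp add: tracial_stateD flip: scaleC_of_real)

lemma tracial_state_minus: "\<tau> \<in> tracial_states \<Longrightarrow> \<tau> (- x) = - \<tau> x"
  using tracial_state_scaleR[of \<tau> "- 1" x] by simp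

lemma tracial_state_diff: "\<tau> \<in> tracial_states \<Longrightarrow> \<tau> (x - y) = \<tau> x - \<tau> y"
  using tracial_stateD(1)[of \<tau> x "- y"] by (simp add: tracial_state_minus)

lemma tracial_state_sum: "\<tau> \<in> tracial_states \<Longrightarrow> \<tau> (\<Sum>i\<in>F. g i) = (\<Sum>i\<in>F. \<tau> (g i))"
  using tracial_state_scaleR[of \<tau> 0 0]
  by (induction F rule: infinite_finite_induct) (simp_all add: tracial_stateD)

text \<open>Four times \<open>a\<close> is the square of \<open>1 + a\<close> minus the square of
  \<open>1 - a\<close>, and the state is nonnegative on both squares.\<close>

lemma tracial_state_real:
  assumes \<tau>: "\<tau> \<in> tracial_states" and "adj a = a"
  shows "Im (\<tau> a) = 0"
proof -
  have pos: "Im (\<tau> ((1 + r *\<^sub>R a) * (1 + r *\<^sub>R a))) = 0" for r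
    using tracial_stateD(3)[OF \<tau>, of "1 + r *\<^sub>R a"] \<open>adj a = a\<close>
    by (simp add: adj_add adj_scaleR complex_nonneg_Reals_iff)
  have "4 *\<^sub>R a = (1 + 1 *\<^sub>R a) * (1 + 1 *\<^sub>R a) - (1 + (-1) *\<^sub>R a) * (1 + (-1) *\<^sub>R a)"
    using scaleR_add_left[of 2 2 a] by (simp add: algebra_simps scaleR_2)
  then have "Im (\<tau> (4 *\<^sub>R a)) = 0"
    using pos[of 1] pos[of "-1"] by (simp only: tracial_state_diff[OF \<tau>] minus_complex.simps)
  then show ?thesis by (simp add: tracial_state_scaleR[OF \<tau>])
qed

text \<open>For \<open>norm a < 1\<close> the element \<open>1 + a\<close> is the square of a self-adjoint binomial series,
  so \<open>\<tau> (1 + a)\<close> is nonnegative.\<close>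

lemma tracial_state_le_norm:
  fixes a :: "'a::unital_cstar_algebra"
  assumes \<tau>: "\<tau> \<in> tracial_states" and "adj a = a"
  shows "\<bar>Re (\<tau> a)\<bar> \<le> norm a"
proof -
  have lt1: "Re (\<tau> a) \<ge> - 1" if "adj a = a" "norm a < 1" for a :: 'a
  proof -
    define y where "y = (\<Sum>n. ((1/2::real) gchoose n) *\<^sub>R a ^ n)"
    have yy: "y * y = 1 + a"
      unfolding y_def by (rule gbinomial_half_series_square) fact
    have "adj y = (\<Sum>n. adj (((1/2::real) gchoose n) *\<^sub>R a ^ n))"
      unfolding y_def using abs_summable_gbinomial_half_power[OF that(2)]
      by (rule bounded_linear.suminf[OF bounded_linear_adj summable_norm_cancel])
    also have "\<dots> = y"
      by (simp add: y_def adj_scaleR adj_power that(1))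
    finally have "\<tau> (1 + a) \<in> \<real>\<^sub>\<ge>\<^sub>0"
      using tracial_stateD(3)[OF \<tau>, of y] yy by simp
    then show ?thesis
      by (simp add: tracial_stateD[OF \<tau>] complex_nonneg_Reals_iff)
  qed
  have lower: "- Re (\<tau> b) \<le> norm b" if b: "adj b = b" for b
  proof (rule field_le_epsilon)
    fix e :: real assume "e > 0"
    \<comment> \<open>Dividing \<open>b\<close> by \<open>norm b + e\<close> instead of
      \<open>norm b\<close> makes the norm strictly less than 1 and also covers
      \<open>b = 0\<close>.\<close>
    then have k: "norm b + e > 0" by (simp add: add_nonneg_pos)
    then have "Re (\<tau> ((1 / (norm b + e)) *\<^sub>R b)) \<ge> - 1"
      using \<open>e > 0\<close> b by (intro lt1) (auto simp: adj_scaleR field_simps)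
    then show "- Re (\<tau> b) \<le> norm b + e"
      using k by (simp add: tracial_state_scaleR[OF \<tau>] field_simps del: of_real_add of_real_divide)
  qed
  show ?thesis
    using lower[of a] lower[of "- a"] assms by (simp add: adj_minus tracial_state_minus)
qed

text \<open>The factor 2 comes from bounding the real and imaginary parts separately. Any uniform
  constant serves for continuity and for compactness of the trace space.\<close>

lemma tracial_state_bound:
  fixes x :: "'a::unital_cstar_algebra"
  assumes \<tau>: "\<tau> \<in> tracial_states"
  shows "cmod (\<tau> x) \<le> 2 * norm x"
proof -
  have sa: "cmod (\<tau> a) \<le> norm a" if "adj a = a" for a
    using tracial_state_le_norm[OF \<tau> that] tracial_state_real[OF \<tau> that]
    by (simp add: cmod_eq_Re)
  have "cmod (\<tau> x) = cmod (\<tau> (re_part x) + \<i> * \<tau> (im_part x))"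
    by (metis re_im_part tracial_stateD(1,2)[OF \<tau>])
  also have "\<dots> \<le> cmod (\<tau> (re_part x)) + cmod (\<tau> (im_part x))"
    using norm_triangle_ineq[of "\<tau> (re_part x)" "\<i> * \<tau> (im_part x)"] by (simp add: norm_mult)
  also have "\<dots> \<le> norm (re_part x) + norm (im_part x)"
    by (intro add_mono sa) simp_all
  also have "\<dots> \<le> 2 * norm x"
    using norm_re_part_le[of x] norm_im_part_le[of x] by simp
  finally show ?thesis .
qed

lemma bounded_linear_tracial_state:
  assumes "\<tau> \<in> tracial_states" shows "bounded_linear \<tau>"
  by (rule bounded_linear_intro[of _ 2])
     (use assms tracial_state_bound[OF assms] in
       \<open>auto simp: tracial_stateD tracial_state_scaleR scaleR_conv_of_real[where 'a = complex] mult.commute\<close>)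

lemma continuous_on_eval: "continuous_on S (\<lambda>\<tau>. \<tau> x)"
  by (rule continuous_on_subset[OF continuous_on_product_coordinates]) simp

text \<open>As in the Banach-Alaoglu theorem, the norm bound places the tracial states in a product
  of closed discs, compact by Tychonoff, where closed conditions on evaluations cut them
  out.\<close>

lemma compact_tracial_states: "compact (tracial_states :: ('a::unital_cstar_algebra \<Rightarrow> complex) set)"
proof -
  let ?P = "PiE UNIV (\<lambda>x::'a. cball (0::complex) (2 * norm x))"
  have "compactin (product_topology (\<lambda>_. euclidean) UNIV) ?P"
    by (simp add: compactin_PiE)
  then have P: "compact ?P"
    by (simp add: euclidean_product_topology)
  have *: "closed {\<tau>::'a \<Rightarrow> complex. g \<tau> = h \<tau>}"
    if "continuous_on UNIV g" "continuous_on UNIV h" for g h :: "('a \<Rightarrow> complex) \<Rightarrow> complex"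
    using that by (rule closed_Collect_eq)
  have **: "closed {\<tau>::'a \<Rightarrow> complex. \<tau> (adj x * x) \<in> \<real>\<^sub>\<ge>\<^sub>0}" for x
    using continuous_closed_preimage[OF continuous_on_eval[of "UNIV :: ('a \<Rightarrow> complex) set" "adj x * x"], of "\<real>\<^sub>\<ge>\<^sub>0"]
    by (simp add: vimage_def closed_nonneg_Reals_complex)
  have "closed (tracial_states :: ('a \<Rightarrow> complex) set)"
    unfolding tracial_states_def
    by (intro closed_Collect_conj closed_Collect_all * ** continuous_intros continuous_on_eval)
  moreover have "tracial_states \<subseteq> ?P"
    using tracial_state_bound by (auto simp: PiE_def)
  ultimately show ?thesis
    using compact_Int_closed[OF P] by (metis inf.absorb2)
qed


section \<open>Continuous affine functions on the trace space\<close>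

lemma convex_comb_tracial_states:
  assumes "\<sigma> \<in> tracial_states" "\<tau> \<in> tracial_states" "s \<in> {0..1}"
  shows "convex_comb s \<sigma> \<tau> \<in> tracial_states"
proof -
  have pos: "convex_comb s \<sigma> \<tau> (adj x * x) \<in> \<real>\<^sub>\<ge>\<^sub>0" for x
    using tracial_stateD(3)[OF assms(1), of x] tracial_stateD(3)[OF assms(2), of x] assms(3)
    unfolding convex_comb_def
    by (intro nonneg_Reals_add_I nonneg_Reals_mult_I) (auto simp del: of_real_diff)
  have "\<sigma> (x * y) = \<sigma> (y * x)" "\<tau> (x * y) = \<tau> (y * x)" for x y
    using assms tracial_stateD(5) by blast+
  with pos show ?thesis
    using assms by (simp add: tracial_states_def[where 'a = 'a] convex_comb_def algebra_simps)
qed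

lemma AffT_affine:
  assumes "f \<in> AffT" "\<sigma> \<in> tracial_states" "\<tau> \<in> tracial_states" "s \<in> {0..1}"
  shows "f (convex_comb s \<sigma> \<tau>) = (1 - s) * f \<sigma> + s * f \<tau>"
  using assms by (simp add: AffT_def)

lemma hat_in_AffT: "hat a \<in> AffT"
proof -
  have "continuous_on tracial_states (hat a)"
    by (rule continuous_on_eq[of _ "\<lambda>\<tau>. Re (\<tau> a)"])
       (auto simp: hat_def intro!: continuous_intros continuous_on_eval)
  then show ?thesis
    using convex_comb_tracial_states by (fastforce simp: AffT_def hat_def convex_comb_def)
qed

lemma AffT_diff:
  assumes "f \<in> AffT" "g \<in> AffT" shows "(\<lambda>\<tau>. f \<tau> - g \<tau>) \<in> AffT"
  using assms by (auto simp: AffT_def algebra_simps intro!: continuous_intros)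

lemma AffT_scale: "f \<in> AffT \<Longrightarrow> (\<lambda>\<tau>. r * f \<tau>) \<in> AffT"
  by (auto simp: AffT_def distrib_left mult.left_commute intro!: continuous_intros)

text \<open>The supremum is finite because \<open>f\<close> is bounded on the compact trace space
  and zero off it.\<close>

lemma AffT_norm_upper:
  fixes f :: "('a::unital_cstar_algebra \<Rightarrow> complex) \<Rightarrow> real"
  assumes "f \<in> AffT" shows "\<bar>f \<tau>\<bar> \<le> AffT_norm f"
proof -
  have "compact (f ` tracial_states)"
    using assms compact_tracial_states by (auto simp: AffT_def intro: compact_continuous_image)
  then obtain M where M: "\<And>\<tau>. \<tau> \<in> tracial_states \<Longrightarrow> \<bar>f \<tau>\<bar> \<le> M"
    using compact_imp_bounded bounded_real by (metis (no_types, lifting) imageI)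
  have "\<bar>f \<tau>\<bar> \<le> max 0 M" for \<tau>
    using M[of \<tau>] assms by (cases "\<tau> \<in> tracial_states") (auto simp: AffT_def)
  then have "bdd_above (range (\<lambda>\<tau>. \<bar>f \<tau>\<bar>))"
    by (intro bdd_aboveI2)
  then show ?thesis
    unfolding AffT_norm_def by (rule cSUP_upper[OF UNIV_I])
qed

lemma AffT_norm_least: "(\<And>\<tau>. \<bar>f \<tau>\<bar> \<le> M) \<Longrightarrow> AffT_norm f \<le> M"
  unfolding AffT_norm_def by (rule cSUP_least) auto

text \<open>Dividing by \<open>s\<close> and letting \<open>s\<close> decrease to 0 gives the
  first-order condition for a minimum along a segment.\<close>

lemma convex_quadratic_min:
  fixes x d :: real
  assumes "\<And>s. 0 < s \<Longrightarrow> s \<le> 1 \<Longrightarrow> 0 \<le> s * d + s\<^sup>2 * x"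
  shows "0 \<le> d"
proof -
  have "0 \<le> d + s * x" if "0 < s" "s \<le> 1" for s
  proof -
    have "0 \<le> s * (d + s * x)" using assms[OF that] by (simp add: algebra_simps power2_eq_square)
    then show ?thesis using that by (simp add: zero_le_mult_iff)
  qed
  then have "eventually (\<lambda>s. 0 \<le> d + s * x) (at_right 0)"
    by (auto simp: eventually_at_right_field intro!: exI[of _ 1])
  moreover have "((\<lambda>s. d + s * x) \<longlongrightarrow> d + 0 * x) (at_right 0)"
    by (intro tendsto_intros)
  ultimately show ?thesis
    using tendsto_lowerbound[of _ "d + 0 * x"] by fastforce
qed

text \<open>Finitely many self-adjoint elements suffice to keep the differences of the graphs of \<open>f\<close> and
  \<open>f + e\<close> away from the origin; the point of this compact convex set with least Euclidean norm in
  the corresponding coordinates gives a separating functional, whose coefficients yield the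
  approximating element.\<close>

lemma AffT_approx_hat:
  fixes f :: "('a::unital_cstar_algebra \<Rightarrow> complex) \<Rightarrow> real"
  assumes f: "f \<in> AffT" and e: "e > 0"
  obtains a where "a \<in> self_adjoint" "\<And>\<tau>. \<bar>f \<tau> - hat a \<tau>\<bar> \<le> e"
proof (cases "tracial_states = ({} :: ('a \<Rightarrow> complex) set)")
  case True
  then show thesis
    using f e by (intro that[of 0]) (auto simp: self_adjoint_def AffT_def hat_def)
next
  case False
  define K where "K = (tracial_states :: ('a \<Rightarrow> complex) set)"
  \<comment> \<open>A pair \<open>p\<close> picks a point of the graph of \<open>f\<close> over
    \<open>fst p\<close> and one of the graph of \<open>f + e\<close> over \<open>snd p\<close>.
    Their difference has horizontal coordinates \<open>q a p\<close> and vertical coordinate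
    \<open>r p\<close>.\<close>
  define q where "q a p = Re (snd p a) - Re (fst p a)" for a and p :: "('a \<Rightarrow> complex) \<times> ('a \<Rightarrow> complex)"
  define r where "r p = f (snd p) - f (fst p) + e" for p
  have KK: "compact (K \<times> K)" unfolding K_def by (intro compact_Times compact_tracial_states)
  have evals: "continuous_on S (\<lambda>p. fst p a)" "continuous_on S (\<lambda>p. snd p a)"
    for S :: "(('a \<Rightarrow> complex) \<times> ('a \<Rightarrow> complex)) set" and a
    using continuous_on_compose2[OF continuous_on_eval[of UNIV a] continuous_on_fst[OF continuous_on_id, of S]]
      continuous_on_compose2[OF continuous_on_eval[of UNIV a] continuous_on_snd[OF continuous_on_id, of S]]
    by simp_all
  have q: "continuous_on S (q a)" for a S
    unfolding q_def by (intro continuous_intros evals)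
  have fK: "continuous_on K f" using f by (simp add: AffT_def K_def)
  have "continuous_on (K \<times> K) (\<lambda>p. f (fst p))" "continuous_on (K \<times> K) (\<lambda>p. f (snd p))"
    using continuous_on_compose2[OF fK continuous_on_fst[OF continuous_on_id, of "K \<times> K"]]
      continuous_on_compose2[OF fK continuous_on_snd[OF continuous_on_id, of "K \<times> K"]]
    by auto
  then have r: "continuous_on (K \<times> K) r"
    unfolding r_def by (intro continuous_intros)
  define C where "C = {p \<in> K \<times> K. r p = 0}"
  have "compact C"
    unfolding C_def by (intro closedin_compact[OF KK] continuous_closedin_preimage_constant r)
  moreover have "open {p. q a p \<noteq> 0}" for a
    by (intro open_Collect_neq q continuous_intros)
  \<comment> \<open>If \<open>r\<close> vanishes at a pair, then \<open>e > 0\<close> forces its two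
    states to differ, so they differ on a self-adjoint element.\<close>
  moreover have "C \<subseteq> (\<Union>a\<in>self_adjoint. {p. q a p \<noteq> 0})"
  proof (clarsimp simp: C_def)
    fix \<sigma> \<tau> assume st: "\<sigma> \<in> K" "\<tau> \<in> K" "r (\<sigma>, \<tau>) = 0"
    then have "\<sigma> \<noteq> \<tau>" using e by (auto simp: r_def)
    then obtain x where x: "\<sigma> x \<noteq> \<tau> x" by blast
    have split: "\<rho> x = \<rho> (re_part x) + \<i> * \<rho> (im_part x)" if "\<rho> \<in> K" for \<rho>
      using that tracial_stateD(1,2)[of \<rho>] unfolding K_def by (metis re_im_part)
    have "\<exists>a. adj a = a \<and> \<sigma> a \<noteq> \<tau> a"
      using x split[OF st(1)] split[OF st(2)] by (metis adj_re_part adj_im_part)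
    then obtain a where a: "adj a = a" "\<sigma> a \<noteq> \<tau> a" by blast
    then have "Re (\<sigma> a) \<noteq> Re (\<tau> a)"
      using st tracial_state_real[of _ a] by (auto simp: K_def complex_eq_iff)
    then show "\<exists>a\<in>self_adjoint. q a (\<sigma>, \<tau>) \<noteq> 0"
      using a by (auto simp: q_def self_adjoint_def)
  qed
  ultimately obtain F where F: "F \<subseteq> self_adjoint" "finite F" "C \<subseteq> (\<Union>a\<in>F. {p. q a p \<noteq> 0})"
    by (rule compactE_image[of C self_adjoint "\<lambda>a. {p. q a p \<noteq> 0}"])
  \<comment> \<open>The squared Euclidean length of the difference in the chosen coordinates;
    \<open>p0\<close> will minimise it.\<close>
  define Q where "Q p = (\<Sum>a\<in>F. (q a p)\<^sup>2) + (r p)\<^sup>2" for p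
  have "continuous_on (K \<times> K) Q"
    unfolding Q_def by (intro continuous_intros q r)
  with KK False obtain p0 where p0: "p0 \<in> K \<times> K" "\<And>p. p \<in> K \<times> K \<Longrightarrow> Q p0 \<le> Q p"
    using continuous_attains_inf[of "K \<times> K" Q] by (auto simp: K_def)
  have Qpos: "Q p > 0" if p: "p \<in> K \<times> K" for p
  proof (cases "r p = 0")
    case True
    then obtain a where "a \<in> F" "q a p \<noteq> 0" using F(3) p by (auto simp: C_def)
    then have "(\<Sum>a\<in>F. (q a p)\<^sup>2) > 0"
      by (intro sum_pos2[OF F(2)]) auto
    then show ?thesis by (simp add: Q_def add_pos_nonneg)
  qed (auto simp: Q_def intro!: add_nonneg_pos sum_nonneg)
  \<comment> \<open>Moving from \<open>p0\<close> towards \<open>p\<close> cannot decrease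
    \<open>Q\<close>, so the inner product of the two difference vectors is at least
    \<open>Q p0\<close>, which is positive.\<close>
  have sep: "0 < (\<Sum>a\<in>F. q a p0 * q a p) + r p0 * r p" if p: "p \<in> K \<times> K" for p
  proof -
    let ?l = "(\<Sum>a\<in>F. q a p0 * q a p) + r p0 * r p"
    define D where "D = (\<Sum>a\<in>F. (q a p - q a p0)\<^sup>2) + (r p - r p0)\<^sup>2"
    have "0 \<le> s * (2 * (?l - Q p0)) + s\<^sup>2 * D" if s: "0 < s" "s \<le> 1" for s
    proof -
      define ps where "ps = (convex_comb s (fst p0) (fst p), convex_comb s (snd p0) (snd p))"
      have ps: "ps \<in> K \<times> K"
        using p p0(1) s by (auto simp: ps_def K_def intro!: convex_comb_tracial_states)
      have qs: "q a ps = q a p0 + s * (q a p - q a p0)" for a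
        by (simp add: q_def ps_def convex_comb_def algebra_simps)
      have rs: "r ps = r p0 + s * (r p - r p0)"
        using p p0(1) s by (auto simp: r_def ps_def K_def AffT_affine[OF f] algebra_simps)
      have sq: "(x + s * (y - x))\<^sup>2 = x\<^sup>2 + (2 * s) * (x * y - x\<^sup>2) + s\<^sup>2 * (y - x)\<^sup>2" for x y :: real
        by (simp add: power2_eq_square algebra_simps)
      have "Q ps = Q p0 + (2 * s) * (?l - Q p0) + s\<^sup>2 * D"
        unfolding Q_def D_def qs rs sq
        by (simp add: sum.distrib sum_subtractf algebra_simps flip: sum_distrib_left)
      then show ?thesis using p0(2)[OF ps] by (simp add: algebra_simps)
    qed
    then have "0 \<le> 2 * (?l - Q p0)" by (rule convex_quadratic_min)
    then show ?thesis using Qpos[OF p0(1)] by simp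
  qed
  define c where "c = r p0"
  obtain k1 where k1: "k1 \<in> K" using False by (auto simp: K_def)
  \<comment> \<open>At a pair of equal states every \<open>q a\<close> is 0 and \<open>r\<close> is
    \<open>e\<close>, so separation reads \<open>0 < c * e\<close>.\<close>
  have c: "c > 0"
    using sep[of "(k1, k1)"] k1 e by (simp add: q_def r_def[of "(k1, k1)"] c_def zero_less_mult_iff)
  \<comment> \<open>With these coefficients, separation divided by \<open>c\<close> says that
    \<open>f - hat b\<close> oscillates by at most \<open>e\<close>. Adding its value at one state
    \<open>k1\<close> as a constant gives the approximation.\<close>
  define b where "b = (- (1/c)) *\<^sub>R (\<Sum>a\<in>F. q a p0 *\<^sub>R a)"
  have "adj b = b"
    using F(1) unfolding b_def
    by (auto simp: adj_scaleR self_adjoint_def adj_minus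
        linear_sum[OF bounded_linear.linear[OF bounded_linear_adj]] intro!: sum.cong)
  have tb: "Re (\<tau> b) = - (1/c) * (\<Sum>a\<in>F. q a p0 * Re (\<tau> a))" if "\<tau> \<in> K" for \<tau>
    using that unfolding b_def K_def
    by (simp add: tracial_state_scaleR tracial_state_sum tracial_state_minus)
  define m where "m \<tau> = f \<tau> - Re (\<tau> b)" for \<tau>
  have m: "m \<sigma> - m \<tau> \<le> e" if "\<sigma> \<in> K" "\<tau> \<in> K" for \<sigma> \<tau>
  proof -
    have "0 < (\<Sum>a\<in>F. q a p0 * (Re (\<tau> a) - Re (\<sigma> a))) + c * (f \<tau> - f \<sigma> + e)"
      using sep[of "(\<sigma>, \<tau>)"] that by (simp add: q_def[of _ "(\<sigma>, \<tau>)"] r_def[of "(\<sigma>, \<tau>)"] c_def)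
    also have "(\<Sum>a\<in>F. q a p0 * (Re (\<tau> a) - Re (\<sigma> a))) = c * (Re (\<sigma> b) - Re (\<tau> b))"
      using c that by (simp add: tb algebra_simps sum_subtractf)
    finally have "0 < c * (m \<tau> - m \<sigma> + e)" by (simp add: m_def algebra_simps)
    then show ?thesis using c by (simp add: zero_less_mult_iff)
  qed
  show thesis
  proof (rule that[of "b + m k1 *\<^sub>R 1"])
    show "b + m k1 *\<^sub>R 1 \<in> self_adjoint"
      using \<open>adj b = b\<close> by (simp add: self_adjoint_def adj_add adj_scaleR)
    fix \<tau>
    show "\<bar>f \<tau> - hat (b + m k1 *\<^sub>R 1) \<tau>\<bar> \<le> e"
    proof (cases "\<tau> \<in> K")
      case True
      then have "f \<tau> - hat (b + m k1 *\<^sub>R 1) \<tau> = m \<tau> - m k1"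
        by (simp add: hat_def K_def m_def tracial_stateD tracial_state_scaleR)
      then show ?thesis using m[of \<tau> k1] m[of k1 \<tau>] True k1 by simp
    next
      case False
      then show ?thesis using f e by (simp add: hat_def K_def AffT_def)
    qed
  qed
qed

section \<open>Uniqueness of the induced map on affine functions\<close>

lemma bounded_linear_AffT_diff:
  assumes "bounded_linear_AffT L" "f \<in> AffT" "g \<in> AffT"
  shows "L (\<lambda>\<tau>. f \<tau> - g \<tau>) = (\<lambda>\<tau>. L f \<tau> - L g \<tau>)"
proof -
  have add: "\<And>f g. f \<in> AffT \<Longrightarrow> g \<in> AffT \<Longrightarrow> L (\<lambda>\<tau>. f \<tau> + g \<tau>) = (\<lambda>\<tau>. L f \<tau> + L g \<tau>)"
    using assms(1) unfolding bounded_linear_AffT_def by blast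
  show ?thesis
    using add[OF AffT_diff[OF assms(2,3)] assms(3)] by (auto simp: fun_eq_iff)
qed

text \<open>Both maps are bounded, and the functions \<open>hat a\<close> on which they agree are
  uniformly dense.\<close>

lemma bounded_linear_AffT_eqI:
  fixes L L' :: "(('a::unital_cstar_algebra \<Rightarrow> complex) \<Rightarrow> real) \<Rightarrow>
    (('b::unital_cstar_algebra \<Rightarrow> complex) \<Rightarrow> real)"
  assumes L: "bounded_linear_AffT L" and L': "bounded_linear_AffT L'"
    and eq: "\<And>a. a \<in> self_adjoint \<Longrightarrow> L (hat a) = L' (hat a)" and f: "f \<in> AffT"
  shows "L f = L' f"
proof
  fix \<tau>
  have bound: "\<exists>M\<ge>0. \<forall>a e. (\<forall>\<sigma>. \<bar>f \<sigma> - hat a \<sigma>\<bar> \<le> e) \<longrightarrow> \<bar>N f \<tau> - N (hat a) \<tau>\<bar> \<le> M * e"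
    if N: "bounded_linear_AffT N"
    for N :: "(('a \<Rightarrow> complex) \<Rightarrow> real) \<Rightarrow> (('b \<Rightarrow> complex) \<Rightarrow> real)"
  proof -
    have img: "N g \<in> AffT" if "g \<in> AffT" for g
      using N that by (simp add: bounded_linear_AffT_def image_subset_iff)
    from N have "\<exists>M. \<forall>g\<in>AffT. AffT_norm (N g) \<le> M * AffT_norm g"
      by (simp add: bounded_linear_AffT_def)
    then obtain M where M: "\<And>g. g \<in> AffT \<Longrightarrow> AffT_norm (N g) \<le> M * AffT_norm g"
      by auto
    \<comment> \<open>The bound \<open>M\<close> carries no sign condition, hence the absolute
      value.\<close>
    have "\<bar>N f \<tau> - N (hat a) \<tau>\<bar> \<le> \<bar>M\<bar> * e" if e: "\<forall>\<sigma>. \<bar>f \<sigma> - hat a \<sigma>\<bar> \<le> e" for a e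
    proof -
      let ?g = "\<lambda>\<tau>. f \<tau> - hat a \<tau>"
      have g: "?g \<in> AffT" by (intro AffT_diff f hat_in_AffT)
      have "0 \<le> AffT_norm ?g" using AffT_norm_upper[OF g, of undefined] by linarith
      have "\<bar>N f \<tau> - N (hat a) \<tau>\<bar> = \<bar>N ?g \<tau>\<bar>"
        by (simp add: bounded_linear_AffT_diff[OF N f hat_in_AffT])
      also have "\<dots> \<le> M * AffT_norm ?g"
        using AffT_norm_upper[OF img[OF g]] M[OF g] by (meson order_trans)
      also have "\<dots> \<le> \<bar>M\<bar> * e"
        using \<open>0 \<le> AffT_norm ?g\<close> AffT_norm_least[of ?g e] e by (intro mult_mono) auto
      finally show ?thesis .
    qed
    then show ?thesis by (intro exI[of _ "\<bar>M\<bar>"]) auto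
  qed
  obtain M where M: "M \<ge> 0" "\<And>a e. \<forall>\<sigma>. \<bar>f \<sigma> - hat a \<sigma>\<bar> \<le> e \<Longrightarrow> \<bar>L f \<tau> - L (hat a) \<tau>\<bar> \<le> M * e"
    using bound[OF L] by auto
  obtain M' where M': "M' \<ge> 0" "\<And>a e. \<forall>\<sigma>. \<bar>f \<sigma> - hat a \<sigma>\<bar> \<le> e \<Longrightarrow> \<bar>L' f \<tau> - L' (hat a) \<tau>\<bar> \<le> M' * e"
    using bound[OF L'] by auto
  have "\<bar>L f \<tau> - L' f \<tau>\<bar> \<le> 0 + d" if "d > 0" for d
  proof -
    \<comment> \<open>The summand 1 keeps the denominator positive when both bounds are
      zero.\<close>
    define e where "e = d / (M + M' + 1)"
    have e: "e > 0" "(M + M') * e \<le> d"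
      using that M(1) M'(1) by (auto simp: e_def field_simps)
    obtain a where a: "a \<in> self_adjoint" "\<And>\<sigma>. \<bar>f \<sigma> - hat a \<sigma>\<bar> \<le> e"
      using AffT_approx_hat[OF f e(1)] by blast
    have "\<bar>L f \<tau> - L' f \<tau>\<bar> \<le> M * e + M' * e"
      using M(2)[of a e] M'(2)[of a e] a(2) eq[OF a(1)] by fastforce
    then show ?thesis using e(2) by (simp add: algebra_simps)
  qed
  then show "L f \<tau> = L' f \<tau>"
    using field_le_epsilon[of "\<bar>L f \<tau> - L' f \<tau>\<bar>" 0] by simp
qed

text \<open>Composition with \<open>T\<close> followed by scaling by \<open>r\<close> satisfies
  every clause of the description defining \<open>Lambda_map\<close>, and density makes it the only
  such map.\<close>

lemma Lambda_map_eq: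
  fixes \<theta> :: "'a::unital_cstar_algebra \<Rightarrow> 'b::unital_cstar_algebra"
  assumes T: "T ` tracial_states \<subseteq> tracial_states" and cont: "continuous_on tracial_states T"
    and aff: "affine_map_T T"
    and S: "\<And>a \<tau>. a \<in> self_adjoint \<Longrightarrow> \<tau> \<in> tracial_states \<Longrightarrow>
      Re (\<tau> (S_map \<theta> a)) = r * Re (T \<tau> a)"
    and f: "f \<in> AffT" and \<tau>: "\<tau> \<in> tracial_states"
  shows "Lambda_map \<theta> f \<tau> = r * f (T \<tau>)"
proof -
  \<comment> \<open>The two zero defaults follow the conventions for functions off the trace space
    and for maps off \<open>AffT\<close>.\<close>
  define L where "L f = (if f \<in> AffT then
    (\<lambda>\<tau>. if \<tau> \<in> tracial_states then r * f (T \<tau>) else 0) else (\<lambda>_. 0))"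
    for f :: "('a \<Rightarrow> complex) \<Rightarrow> real"
  have LAff: "L f \<in> AffT" if f: "f \<in> AffT" for f
  proof -
    have "continuous_on tracial_states f" using f by (simp add: AffT_def)
    then have "continuous_on tracial_states (\<lambda>\<tau>. r * f (T \<tau>))"
      by (intro continuous_intros continuous_on_compose2[OF _ cont T])
    then have "continuous_on tracial_states (L f)"
      by (rule continuous_on_eq) (simp add: L_def f)
    moreover have "f (T (convex_comb s \<sigma> \<tau>)) = (1 - s) * f (T \<sigma>) + s * f (T \<tau>)"
      if "\<sigma> \<in> tracial_states" "\<tau> \<in> tracial_states" "s \<in> {0..1}" for \<sigma> \<tau> s
    proof -
      have "T (convex_comb s \<sigma> \<tau>) = convex_comb s (T \<sigma>) (T \<tau>)"
        using that aff by (simp add: affine_map_T_def)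
      then show ?thesis
        using AffT_affine[OF f, of "T \<sigma>" "T \<tau>" s] that T by (simp add: image_subset_iff)
    qed
    then have "\<forall>\<sigma>\<in>tracial_states. \<forall>\<tau>\<in>tracial_states. \<forall>s\<in>{0..1}.
        L f (convex_comb s \<sigma> \<tau>) = (1 - s) * L f \<sigma> + s * L f \<tau>"
      by (simp add: L_def f convex_comb_tracial_states distrib_left mult.left_commute)
    ultimately show ?thesis
      by (simp add: AffT_def[where 'a = 'b]) (simp add: L_def)
  qed
  have bound: "AffT_norm (L f) \<le> \<bar>r\<bar> * AffT_norm f" if "f \<in> AffT" for f
  proof (rule AffT_norm_least)
    fix \<tau>
    have "0 \<le> AffT_norm f" using AffT_norm_upper[OF that, of undefined] by linarith
    then show "\<bar>L f \<tau>\<bar> \<le> \<bar>r\<bar> * AffT_norm f"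
      using AffT_norm_upper[OF that, of "T \<tau>"] by (auto simp: L_def abs_mult mult_left_mono)
  qed
  have add_in: "(\<lambda>\<tau>. f \<tau> + g \<tau>) \<in> AffT" if "f \<in> AffT" "g \<in> AffT"
    for f g :: "('a \<Rightarrow> complex) \<Rightarrow> real"
    using AffT_diff[OF that(1) AffT_scale[OF that(2), of "- 1"]] by simp
  have L: "bounded_linear_AffT L"
    unfolding bounded_linear_AffT_def
  proof (intro conjI ballI allI)
    show "L ` AffT \<subseteq> AffT" using LAff by auto
    show "\<exists>K. \<forall>f\<in>AffT. AffT_norm (L f) \<le> K * AffT_norm f" using bound by auto
  next
    fix f g :: "('a \<Rightarrow> complex) \<Rightarrow> real" assume "f \<in> AffT" "g \<in> AffT"
    then show "L (\<lambda>\<tau>. f \<tau> + g \<tau>) = (\<lambda>\<tau>. L f \<tau> + L g \<tau>)"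
      using add_in by (auto simp: L_def distrib_left)
  next
    fix k and f :: "('a \<Rightarrow> complex) \<Rightarrow> real" assume "f \<in> AffT"
    then show "L (\<lambda>\<tau>. k * f \<tau>) = (\<lambda>\<tau>. k * L f \<tau>)"
      using AffT_scale[of f k] by (auto simp: L_def)
  qed
  have hat: "L (hat a) = hat (S_map \<theta> a)" if "a \<in> self_adjoint" for a
  proof
    fix \<tau>
    show "L (hat a) \<tau> = hat (S_map \<theta> a) \<tau>"
    proof (cases "\<tau> \<in> tracial_states")
      case True
      then have "T \<tau> \<in> tracial_states" using T by auto
      with True show ?thesis
        using S[OF that True] hat_in_AffT[of a] by (simp only: L_def if_True) (simp add: hat_def)
    qed (simp add: L_def hat_in_AffT, simp add: hat_def)
  qed
  have "Lambda_map \<theta> = L"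
    unfolding Lambda_map_def
  proof (rule the_equality)
    show "bounded_linear_AffT L \<and> (\<forall>a\<in>self_adjoint. L (hat a) = hat (S_map \<theta> a)) \<and>
      (\<forall>f. f \<notin> AffT \<longrightarrow> L f = (\<lambda>_. 0))"
      using L hat by (simp add: L_def)
  next
    fix N assume N: "bounded_linear_AffT N \<and> (\<forall>a\<in>self_adjoint. N (hat a) = hat (S_map \<theta> a)) \<and>
      (\<forall>f. f \<notin> AffT \<longrightarrow> N f = (\<lambda>_. 0))"
    show "N = L"
    proof
      fix f
      show "N f = L f"
        using N hat bounded_linear_AffT_eqI[of N L f] L by (cases "f \<in> AffT") (auto simp: L_def)
    qed
  qed
  then show ?thesis using f \<tau> by (simp add: L_def)
qed


section \<open>The linear map induced by a contractive homomorphism\<close>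

lemma tendsto_difference_quotient_at_0:
  assumes "(h has_vector_derivative h') (at 0)"
  shows "((\<lambda>t. (h t - h 0) /\<^sub>R t) \<longlongrightarrow> h') (at 0)"
proof (rule Lim_null[THEN iffD2], rule tendsto_norm_zero_cancel)
  have "((\<lambda>t. norm (h t - h 0 - t *\<^sub>R h') / norm t) \<longlongrightarrow> 0) (at 0)"
    using assms by (simp add: has_vector_derivative_def has_derivative_iff_norm)
  moreover have "norm (h t - h 0 - t *\<^sub>R h') / norm t = norm ((h t - h 0) /\<^sub>R t - h')" if "t \<noteq> 0" for t
  proof -
    have "(h t - h 0) /\<^sub>R t - h' = (h t - h 0 - t *\<^sub>R h') /\<^sub>R t"
      using that by (simp add: scaleR_diff_right)
    then show ?thesis by (simp add: divide_inverse mult.commute)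
  qed
  ultimately show "((\<lambda>t. norm ((h t - h 0) /\<^sub>R t - h')) \<longlongrightarrow> 0) (at 0)"
    by (auto elim!: Lim_transform_eventually simp: eventually_at_filter)
qed

text \<open>This limit of difference quotients turns contractivity of a homomorphism into norm
  inequalities for generators.\<close>

lemma norm_vector_derivative_le:
  fixes f :: "real \<Rightarrow> 'a::real_normed_vector" and g :: "real \<Rightarrow> 'b::real_normed_vector"
  assumes f: "(f has_vector_derivative f') (at 0)" and g: "(g has_vector_derivative g') (at 0)"
    and le: "\<And>t. norm (f t - f 0) \<le> norm (g t - g 0)"
  shows "norm f' \<le> norm g'"
proof -
  note lim = tendsto_norm[OF tendsto_difference_quotient_at_0]
  show ?thesis
    using le by (intro tendsto_le[OF _ lim[OF g] lim[OF f]]) (auto intro!: always_eventually mult_left_mono)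
qed

section \<open>A norm criterion for tracial states\<close>

text \<open>Only positivity needs an argument. For \<open>x = a + \<i> *\<^sub>C b\<close> the trace
  property cancels the cross terms of \<open>adj x * x\<close>, which reduces it to squares of
  self-adjoint elements.\<close>

lemma tracial_state_of_norm_le:
  fixes \<phi> :: "'a::unital_cstar_algebra \<Rightarrow> complex"
  assumes bl: "bounded_linear \<phi>" and scaleC: "\<And>c x. \<phi> (c *\<^sub>C x) = c * \<phi> x"
    and trace: "\<And>x y. \<phi> (x * y) = \<phi> (y * x)" and one: "\<phi> 1 = 1"
    and real: "\<And>a. adj a = a \<Longrightarrow> Im (\<phi> a) = 0"
    and le: "\<And>a. adj a = a \<Longrightarrow> Re (\<phi> a) \<le> norm a"
  shows "\<phi> \<in> tracial_states"
proof -
  interpret bounded_linear \<phi> by fact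
  note minus = linear_neg[OF bounded_linear.linear[OF bl]]
  text \<open>\<open>t \<mapsto> Re (\<phi> (2 cos (t a)))\<close> is maximal at \<open>0\<close>, since \<open>norm (cos (t a)) \<le> 1\<close>; its second
    derivative there is \<open>- 2 Re (\<phi> (a\<^sup>2))\<close>.\<close>
  have sq: "0 \<le> Re (\<phi> (a * a))" if a: "adj a = a" for a
  proof -
    define c where "c = \<i> *\<^sub>C a"
    have c: "adj c = - c" "c * c = - (a * a)"
      using a by (simp_all add: c_def adj_scaleC scaleC_minus_left mult_scaleC_left
          mult_scaleC_right scaleC_scaleC)
    define g where "g t = Re (\<phi> (exp (t *\<^sub>R c) + exp (t *\<^sub>R (- c))))" for t
    define g' where "g' t = Re (\<phi> (exp (t *\<^sub>R c) * c + exp (t *\<^sub>R (- c)) * (- c)))" for t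
    have blRe: "bounded_linear (\<lambda>x. Re (\<phi> x))"
      by (rule bounded_linear_compose[OF bounded_linear_Re bl])
    have ex: "((\<lambda>t. exp (t *\<^sub>R d)) has_vector_derivative exp (t *\<^sub>R d) * d) (at t)" for d :: 'a and t
      by (rule exp_scaleR_has_vector_derivative_right)
    have "(g has_real_derivative g' t) (at t)" for t
      unfolding g_def g'_def has_real_derivative_iff_has_vector_derivative
      by (intro bounded_linear.has_vector_derivative[OF blRe] has_vector_derivative_add ex)
    moreover have "(g' has_real_derivative Re (\<phi> (exp (0 *\<^sub>R c) * c * c + exp (0 *\<^sub>R (- c)) * (- c) * (- c)))) (at 0)"
      unfolding g'_def has_real_derivative_iff_has_vector_derivative
      by (intro bounded_linear.has_vector_derivative[OF blRe] has_vector_derivative_add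
          has_vector_derivative_mult_left ex)
    moreover have "g' 0 = 0"
      by (simp add: g'_def zero)
    moreover have "g t \<le> g 0" for t
    proof -
      let ?y = "exp (t *\<^sub>R c) + exp (t *\<^sub>R (- c))"
      have "adj ?y = ?y"
        by (simp add: adj_add adj_exp adj_scaleR adj_minus c add.commute)
      then have "g t \<le> norm ?y" unfolding g_def by (rule le)
      also have "\<dots> \<le> norm (exp (t *\<^sub>R c)) + norm (exp (t *\<^sub>R (- c)))"
        by (rule norm_triangle_ineq)
      also have "\<dots> = 2"
        using exp_skew_unitary[of "t *\<^sub>R c"] exp_skew_unitary[of "t *\<^sub>R (- c)"] c(1)
        by (simp add: norm_unitary adj_scaleR adj_minus)
      also have "\<dots> = g 0" by (simp add: g_def add one del: one_add_one)
      finally show ?thesis .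
    qed
    ultimately have "Re (\<phi> (exp (0 *\<^sub>R c) * c * c + exp (0 *\<^sub>R (- c)) * (- c) * (- c))) \<le> 0"
      by (rule second_derivative_nonpos_at_max)
    then show ?thesis
      by (simp add: c minus linear_diff[OF bounded_linear.linear[OF bl]])
  qed
  have "\<phi> (adj x * x) \<in> \<real>\<^sub>\<ge>\<^sub>0" for x
  proof -
    define a b where "a = re_part x" and "b = im_part x"
    have ab: "adj a = a" "adj b = b" by (simp_all add: a_def b_def)
    have x: "x = a + \<i> *\<^sub>C b" by (simp add: a_def b_def re_im_part)
    have "\<phi> (adj x * x) = \<phi> (a * a) + \<phi> (b * b)"
      unfolding x
      by (simp add: adj_add adj_scaleC ab distrib_left distrib_right mult_scaleC_left
          mult_scaleC_right scaleC_scaleC add scaleC scaleC_minus_left minus trace[of b a]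
          left_diff_distrib right_diff_distrib linear_diff[OF bounded_linear.linear[OF bl]])
    moreover have "Im (\<phi> (adj x * x)) = 0"
      by (rule real) (simp add: adj_mult adj_adj)
    ultimately show ?thesis
      using sq[OF ab(1)] sq[OF ab(2)] by (simp add: complex_nonneg_Reals_iff)
  qed
  then show ?thesis
    using scaleC trace one by (simp add: tracial_states_def add)
qed

text \<open>Separating this factor from the parameter writes the groups as
  \<open>exp (t *\<^sub>R two_pi_i a)\<close>, so that calculus in the real variable
  \<open>t\<close> applies.\<close>

definition two_pi_i :: "'a::unital_cstar_algebra \<Rightarrow> 'a" where
  "two_pi_i x = (2 * pi * \<i>) *\<^sub>C x"

lemma two_pi_i_scaleR: "(2 * pi * \<i> * t) *\<^sub>C x = t *\<^sub>R two_pi_i x"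
  by (simp add: two_pi_i_def scaleR_scaleC mult_ac)

lemma bounded_linear_two_pi_i: "bounded_linear two_pi_i"
  unfolding two_pi_i_def[abs_def] by (rule bounded_linear_scaleC)

lemmas two_pi_i_add = linear_add[OF bounded_linear.linear[OF bounded_linear_two_pi_i]]

lemma norm_two_pi_i: "norm (two_pi_i x) = 2 * pi * norm x"
  by (simp add: two_pi_i_def norm_scaleC norm_mult)

lemma two_pi_i_scaleC_inverse [simp]:
  "two_pi_i ((1 / (2 * pi * \<i>)) *\<^sub>C x) = x" "(1 / (2 * pi * \<i>)) *\<^sub>C two_pi_i x = x"
  by (simp_all add: two_pi_i_def scaleC_scaleC)

lemma two_pi_i_inject [simp]: "two_pi_i x = two_pi_i y \<longleftrightarrow> x = y"
  by (metis two_pi_i_scaleC_inverse(2))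

lemma adj_two_pi_i: "adj (two_pi_i x) = - two_pi_i (adj x)"
  by (simp add: two_pi_i_def adj_scaleC scaleC_minus_left)

lemma mult_two_pi_i: "x * two_pi_i y * z = two_pi_i (x * y * z)"
  by (simp add: two_pi_i_def mult_scaleC_left mult_scaleC_right)

lemma exp_two_pi_i_scaleC_one:
  "exp (t *\<^sub>R two_pi_i (z *\<^sub>C 1)) = exp (2 * pi * \<i> * t * z) *\<^sub>C (1::'a::unital_cstar_algebra)"
  by (simp add: scaleC_scaleC exp_scaleC_one flip: two_pi_i_scaleR)

section \<open>The generator map of a contractive homomorphism\<close>

locale contractive_unitary_hom =
  fixes \<theta> :: "'a::unital_cstar_algebra \<Rightarrow> 'b::unital_cstar_algebra"
  assumes maps_U0: "u \<in> U0 \<Longrightarrow> \<theta> u \<in> U0"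
    and hom_mult: "u \<in> U0 \<Longrightarrow> v \<in> U0 \<Longrightarrow> \<theta> (u * v) = \<theta> u * \<theta> v"
    and contractive: "u \<in> U0 \<Longrightarrow> v \<in> U0 \<Longrightarrow> norm (\<theta> u - \<theta> v) \<le> norm (u - v)"
begin

abbreviation "S \<equiv> S_map \<theta>"

lemma hom_unitary: "u \<in> U0 \<Longrightarrow> \<theta> u \<in> unitaries"
  using maps_U0 U0_subset_unitaries by auto

text \<open>An idempotent unitary is 1.\<close>

lemma hom_one: "\<theta> 1 = 1"
proof -
  have "\<theta> 1 * \<theta> 1 = \<theta> 1" using hom_mult[OF one_in_U0 one_in_U0] by simp
  moreover have "adj (\<theta> 1) * \<theta> 1 = 1"
    using hom_unitary[OF one_in_U0] by (simp add: unitaries_def)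
  ultimately show ?thesis by (metis mult.assoc mult_1_left)
qed

lemma exp_two_pi_i_in_U0: "adj a = a \<Longrightarrow> exp (t *\<^sub>R two_pi_i (a::'a)) \<in> U0"
  by (rule exp_skew_in_U0) (simp add: adj_scaleR adj_two_pi_i)

text \<open>The image of the group of \<open>a\<close> is a norm-continuous one-parameter group,
  hence an exponential. Its values are unitary, which makes the generator skew-adjoint, that is,
  \<open>two_pi_i\<close> of a self-adjoint element.\<close>

lemma ex_generator:
  fixes a :: 'a
  assumes a: "adj a = a"
  obtains b where "adj b = b" "\<And>t. \<theta> (exp (t *\<^sub>R two_pi_i a)) = exp (t *\<^sub>R two_pi_i b)"
proof -
  let ?v = "\<lambda>t. exp (t *\<^sub>R two_pi_i a)"
  define u where "u t = \<theta> (?v t)" for t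
  have v: "?v t \<in> U0" for t using a by (rule exp_two_pi_i_in_U0)
  have u0: "u 0 = 1" by (simp add: u_def hom_one)
  have u_add: "u (s + t) = u s * u t" for s t
  proof -
    have "?v (s + t) = ?v s * ?v t"
      unfolding scaleR_add_left by (rule exp_add_commuting) simp
    then show ?thesis using hom_mult[OF v v] by (simp add: u_def)
  qed
  have cv: "continuous_on UNIV ?v"
    by (intro continuous_on_vector_derivative[OF exp_scaleR_has_vector_derivative_right])
  have "continuous_on UNIV u"
    unfolding continuous_on_iff
  proof (intro ballI allI impI)
    fix t e :: real assume "e > 0"
    then obtain d where "d > 0" "\<And>s. dist s t < d \<Longrightarrow> dist (?v s) (?v t) < e"
      using cv unfolding continuous_on_iff by fastforce
    then show "\<exists>d>0. \<forall>s\<in>UNIV. dist s t < d \<longrightarrow> dist (u s) (u t) < e"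
      using contractive[OF v v] unfolding u_def dist_norm by (meson order_le_less_trans)
  qed
  with u0 u_add obtain c where c: "\<And>t. u t = exp (t *\<^sub>R c)"
    using one_parameter_group_eq_exp by blast
  have "adj (u t) = u (- t)" for t
  proof -
    have "adj (u t) * u t = 1" using hom_unitary[OF v] by (simp add: u_def unitaries_def)
    moreover have "u t * u (- t) = 1" using u_add[of t "- t"] u0 by simp
    ultimately show ?thesis by (metis mult.assoc mult_1_left mult_1_right)
  qed
  then have "exp (t *\<^sub>R adj c) = exp (t *\<^sub>R (- c))" for t
    by (simp add: c adj_exp adj_scaleR)
  then have adj_c: "adj c = - c" by (rule exp_scaleR_inject)
  define b where "b = (1 / (2 * pi * \<i>)) *\<^sub>C c"
  have Jb: "two_pi_i b = c" by (simp only: b_def two_pi_i_scaleC_inverse)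
  have "two_pi_i (adj b) = two_pi_i b"
    using adj_two_pi_i[of b] adj_c by (simp add: Jb)
  then have "adj b = b" by simp
  with c Jb show thesis by (intro that[of b]) (auto simp: u_def)
qed

text \<open>A generator exists and is determined by its group, so the definite description behind
  \<open>S\<close> denotes it.\<close>

lemma S_generator:
  fixes a :: 'a
  assumes a: "adj a = a"
  shows adj_S: "adj (S a) = S a"
    and hom_exp: "\<theta> (exp (t *\<^sub>R two_pi_i a)) = exp (t *\<^sub>R two_pi_i (S a))"
proof -
  obtain b where b: "adj b = b" "\<And>t. \<theta> (exp (t *\<^sub>R two_pi_i a)) = exp (t *\<^sub>R two_pi_i b)"
    using ex_generator[OF a] by blast
  have "S a = b"
    unfolding S_map_def two_pi_i_scaleR
  proof (rule the_equality)
    show "b \<in> self_adjoint \<and> (\<forall>t. \<theta> (exp (t *\<^sub>R two_pi_i a)) = exp (t *\<^sub>R two_pi_i b))"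
      using b by (simp add: self_adjoint_def)
    fix b' assume "b' \<in> self_adjoint \<and> (\<forall>t. \<theta> (exp (t *\<^sub>R two_pi_i a)) = exp (t *\<^sub>R two_pi_i b'))"
    then have "exp (t *\<^sub>R two_pi_i b') = exp (t *\<^sub>R two_pi_i b)" for t
      using b by metis
    then have "two_pi_i b' = two_pi_i b" by (rule exp_scaleR_inject)
    then show "b' = b" by simp
  qed
  then show "adj (S a) = S a" "\<theta> (exp (t *\<^sub>R two_pi_i a)) = exp (t *\<^sub>R two_pi_i (S a))"
    using b by auto
qed

lemma exp_derivative_0:
  "((\<lambda>t. exp (t *\<^sub>R x)) has_vector_derivative x) (at 0)" for x :: "'c::{real_normed_algebra_1,banach}"
  using exp_scaleR_has_vector_derivative_right[of x 0 UNIV] by simp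

text \<open>By contractivity, the derivative of \<open>\<theta> \<circ> \<gamma>\<close> at \<open>0\<close> depends only on that of \<open>\<gamma>\<close>.\<close>

lemma S_eqI:
  fixes a :: 'a
  assumes a: "adj a = a" and \<gamma>: "\<And>t. \<gamma> t \<in> U0" "\<gamma> 0 = 1"
    and d: "(\<gamma> has_vector_derivative two_pi_i a) (at 0)"
    and d': "((\<lambda>t. \<theta> (\<gamma> t)) has_vector_derivative two_pi_i b) (at 0)"
  shows "S a = b"
proof -
  let ?v = "\<lambda>t. exp (t *\<^sub>R two_pi_i a)"
  have "((\<lambda>t. \<theta> (?v t)) has_vector_derivative two_pi_i (S a)) (at 0)"
    using exp_derivative_0 by (simp add: hom_exp[OF a])
  from has_vector_derivative_diff[OF d' this] has_vector_derivative_diff[OF d exp_derivative_0]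
  have "norm (two_pi_i b - two_pi_i (S a)) \<le> norm (two_pi_i a - two_pi_i a)"
    by (rule norm_vector_derivative_le) (simp add: \<gamma> contractive exp_two_pi_i_in_U0[OF a])
  then show ?thesis by simp
qed

text \<open>The product of the two groups has the sum of their generators as derivative at 0,
  whether or not \<open>a\<close> and \<open>b\<close> commute, and so has its image.\<close>

lemma S_add:
  fixes a b :: 'a
  assumes a: "adj a = a" and b: "adj b = b"
  shows "S (a + b) = S a + S b"
proof (rule S_eqI)
  let ?\<gamma> = "\<lambda>t. exp (t *\<^sub>R two_pi_i a) * exp (t *\<^sub>R two_pi_i b)"
  show "adj (a + b) = a + b" by (simp add: adj_add a b)
  show "?\<gamma> t \<in> U0" for t using a b by (intro U0_mult exp_two_pi_i_in_U0)
  show "?\<gamma> 0 = 1" by simp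
  show "(?\<gamma> has_vector_derivative two_pi_i (a + b)) (at 0)"
    using has_vector_derivative_mult[OF exp_derivative_0 exp_derivative_0, of "two_pi_i a" "two_pi_i b"]
    by (simp add: two_pi_i_add add.commute)
  show "((\<lambda>t. \<theta> (?\<gamma> t)) has_vector_derivative two_pi_i (S a + S b)) (at 0)"
    using has_vector_derivative_mult[OF exp_derivative_0 exp_derivative_0, of "two_pi_i (S a)" "two_pi_i (S b)"] a b
    by (simp add: two_pi_i_add add.commute hom_mult exp_two_pi_i_in_U0 hom_exp)
qed

lemma S_scaleR:
  fixes a :: 'a
  assumes a: "adj a = a"
  shows "S (r *\<^sub>R a) = r *\<^sub>R S a"
proof (rule S_eqI)
  let ?\<gamma> = "\<lambda>t. exp (t *\<^sub>R two_pi_i (r *\<^sub>R a))"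
  have scale: "two_pi_i (r *\<^sub>R x) = r *\<^sub>R two_pi_i x" for x :: "'c::unital_cstar_algebra"
    by (simp add: two_pi_i_def scaleC_scaleR)
  show ra: "adj (r *\<^sub>R a) = r *\<^sub>R a" by (simp add: adj_scaleR a)
  show "?\<gamma> t \<in> U0" for t using ra by (rule exp_two_pi_i_in_U0)
  show "?\<gamma> 0 = 1" by simp
  show "(?\<gamma> has_vector_derivative two_pi_i (r *\<^sub>R a)) (at 0)" by (rule exp_derivative_0)
  \<comment> \<open>The curve is the group of \<open>a\<close> run at parameter
    \<open>t * r\<close>.\<close>
  have "\<theta> (?\<gamma> t) = exp (t *\<^sub>R two_pi_i (r *\<^sub>R S a))" for t
    using hom_exp[OF a, of "t * r"] by (simp add: scale)
  then show "((\<lambda>t. \<theta> (?\<gamma> t)) has_vector_derivative two_pi_i (r *\<^sub>R S a)) (at 0)"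
    using exp_derivative_0 by simp
qed

lemma norm_S_le:
  fixes a :: 'a
  assumes a: "adj a = a"
  shows "norm (S a) \<le> norm a"
proof -
  have "norm (two_pi_i (S a)) \<le> norm (two_pi_i a)"
    by (rule norm_vector_derivative_le[OF exp_derivative_0 exp_derivative_0])
       (use contractive[OF exp_two_pi_i_in_U0[OF a] one_in_U0] in
         \<open>simp add: hom_exp[OF a, symmetric] hom_one\<close>)
  then show ?thesis by (simp add: norm_two_pi_i)
qed

text \<open>The homomorphism sends the conjugated group of \<open>a\<close> to the conjugated group
  of \<open>S a\<close>; both are differentiated at 0.\<close>

lemma S_conj:
  fixes a h :: 'a
  assumes a: "adj a = a" and h: "adj h = - h"
  shows "S (exp h * a * exp (- h)) = \<theta> (exp h) * S a * \<theta> (exp (- h))"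
proof (rule S_eqI)
  let ?\<gamma> = "\<lambda>t. exp h * exp (t *\<^sub>R two_pi_i a) * exp (- h)"
  have U: "exp h \<in> U0" "exp (- h) \<in> U0"
    using h by (auto intro!: exp_skew_in_U0 simp: adj_minus)
  show "adj (exp h * a * exp (- h)) = exp h * a * exp (- h)"
    by (simp add: adj_mult adj_exp a h adj_minus mult.assoc)
  show "?\<gamma> t \<in> U0" for t using a U by (intro U0_mult exp_two_pi_i_in_U0)
  show "?\<gamma> 0 = 1" by (simp add: exp_minus_inverse)
  show "(?\<gamma> has_vector_derivative two_pi_i (exp h * a * exp (- h))) (at 0)"
    by (subst mult_two_pi_i[symmetric])
       (intro has_vector_derivative_mult_left has_vector_derivative_mult_right exp_derivative_0)
  have "\<theta> (?\<gamma> t) = \<theta> (exp h) * exp (t *\<^sub>R two_pi_i (S a)) * \<theta> (exp (- h))" for t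
    using U a by (simp add: hom_mult U0_mult exp_two_pi_i_in_U0 hom_exp)
  then show "((\<lambda>t. \<theta> (?\<gamma> t)) has_vector_derivative
      two_pi_i (\<theta> (exp h) * S a * \<theta> (exp (- h)))) (at 0)"
    by (simp only: flip: mult_two_pi_i)
       (intro has_vector_derivative_mult_left has_vector_derivative_mult_right exp_derivative_0)
qed

section \<open>The complex-linear extension and traces\<close>

text \<open>\<open>S\<close> is under control on self-adjoint elements, while a tracial state lives
  on the whole algebra; \<open>E\<close> is the complex-linear extension.\<close>

definition E :: "'a \<Rightarrow> 'b" where
  "E x = S (re_part x) + \<i> *\<^sub>C S (im_part x)"

lemma E_self_adjoint:
  assumes "adj a = a" shows "E a = S a"
proof -
  have "S 0 = 0" using S_scaleR[of 0 0] by simp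
  then show ?thesis
    using assms by (simp add: E_def re_part_self_adjoint im_part_self_adjoint)
qed

lemma E_add: "E (x + y) = E x + E y"
  by (simp add: E_def re_part_add im_part_add S_add scaleC_add_right)

lemma E_scaleR: "E (r *\<^sub>R x) = r *\<^sub>R E x"
  by (simp add: E_def re_part_scaleR im_part_scaleR S_scaleR scaleR_add_right scaleC_scaleR)

lemma E_scaleC: "E (c *\<^sub>C x) = c *\<^sub>C E x"
proof -
  have "S (- im_part x) = - S (im_part x)"
    using S_scaleR[of "im_part x" "- 1"] by simp
  then have i: "E (\<i> *\<^sub>C x) = \<i> *\<^sub>C E x"
    by (simp add: E_def re_part_scaleC_i im_part_scaleC_i scaleC_add_right scaleC_scaleC
        scaleC_minus_left)
  have split: "c *\<^sub>C y = Re c *\<^sub>R y + Im c *\<^sub>R (\<i> *\<^sub>C y)" for y :: "'c::unital_cstar_algebra"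
    by (subst complex_eq[of c])
       (simp add: scaleC_add_left scaleC_of_real scaleR_scaleC mult.commute)
  show ?thesis by (simp add: split E_add E_scaleR i)
qed

lemma bounded_linear_E: "bounded_linear E"
proof (rule bounded_linear_intro[of _ 2])
  fix x
  have "norm (E x) \<le> norm (S (re_part x)) + norm (\<i> *\<^sub>C S (im_part x))"
    unfolding E_def by (rule norm_triangle_ineq)
  also have "\<dots> \<le> norm (re_part x) + norm (im_part x)"
    by (simp add: norm_scaleC add_mono norm_S_le)
  also have "\<dots> \<le> norm x * 2"
    using norm_re_part_le[of x] norm_im_part_le[of x] by simp
  finally show "norm (E x) \<le> norm x * 2" .
qed (auto simp: E_add E_scaleR)

text \<open>Conjugation by \<open>exp h\<close> becomes conjugation by
  \<open>\<theta> (exp h)\<close>, which a trace does not see. Real and imaginary parts commute with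
  conjugation by a unitary, so this passes from \<open>S\<close> to \<open>E\<close>.\<close>

lemma tracial_state_E_conj:
  assumes \<tau>: "\<tau> \<in> tracial_states" and h: "adj h = - h"
  shows "\<tau> (E (exp h * x * exp (- h))) = \<tau> (E x)"
proof -
  have U: "exp h \<in> U0" "exp (- h) \<in> U0"
    using h by (auto intro!: exp_skew_in_U0 simp: adj_minus)
  have inv: "\<theta> (exp (- h)) * \<theta> (exp h) = 1"
    using hom_mult[OF U(2,1)] exp_minus_inverse[of "- h"] by (simp add: hom_one)
  have S: "\<tau> (S (exp h * a * exp (- h))) = \<tau> (S a)" if "adj a = a" for a
  proof -
    have "\<tau> (S (exp h * a * exp (- h))) = \<tau> (\<theta> (exp (- h)) * (\<theta> (exp h) * S a))"
      unfolding S_conj[OF that h] by (rule tracial_stateD(5)[OF \<tau>])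
    then show ?thesis by (simp add: inv flip: mult.assoc)
  qed
  have "adj (exp h * x * exp (- h)) = exp h * adj x * exp (- h)"
    by (simp add: adj_mult adj_exp h adj_minus mult.assoc)
  then have "re_part (exp h * x * exp (- h)) = exp h * re_part x * exp (- h)"
    "im_part (exp h * x * exp (- h)) = exp h * im_part x * exp (- h)"
    by (simp_all add: re_part_def im_part_def mult_scaleC_left mult_scaleC_right algebra_simps)
  then show ?thesis
    by (simp add: E_def tracial_stateD(1,2)[OF \<tau>] S)
qed

text \<open>Differentiating conjugation invariance at 0 annihilates commutators with skew-adjoint
  elements, and these span the algebra over the complex numbers.\<close>

lemma tracial_state_E_commute:
  assumes \<tau>: "\<tau> \<in> tracial_states"
  shows "\<tau> (E (x * y)) = \<tau> (E (y * x))"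
proof -
  have bl: "bounded_linear (\<lambda>x. \<tau> (E x))"
    by (rule bounded_linear_compose[OF bounded_linear_tracial_state[OF \<tau>] bounded_linear_E])
  have skew: "\<tau> (E (h * y)) = \<tau> (E (y * h))" if h: "adj h = - h" for h
  proof -
    have "((\<lambda>t. \<tau> (E (exp (t *\<^sub>R h) * y * exp (t *\<^sub>R (- h))))) has_vector_derivative
        \<tau> (E (exp (0 *\<^sub>R h) * y * (- h) + h * y * exp (0 *\<^sub>R (- h))))) (at 0)"
      by (intro bounded_linear.has_vector_derivative[OF bl] has_vector_derivative_mult
          has_vector_derivative_mult_left exp_derivative_0)
    moreover have "\<tau> (E (exp (t *\<^sub>R h) * y * exp (t *\<^sub>R (- h)))) = \<tau> (E y)" for t
      using tracial_state_E_conj[OF \<tau>, of "t *\<^sub>R h" y] h by (simp add: adj_scaleR)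
    ultimately have "((\<lambda>t::real. \<tau> (E y)) has_vector_derivative \<tau> (E (h * y - y * h))) (at 0)"
      by simp
    then have "\<tau> (E (h * y - y * h)) = 0"
      by (rule vector_derivative_unique_at[OF _ has_vector_derivative_const])
    then show ?thesis
      using linear_diff[OF bounded_linear.linear[OF bl], of "h * y" "y * h"] by simp
  qed
  have sa: "\<tau> (E (a * y)) = \<tau> (E (y * a))" if a: "adj a = a" for a
    using skew[of "\<i> *\<^sub>C a"] a
    by (simp add: adj_scaleC scaleC_minus_left mult_scaleC_left mult_scaleC_right E_scaleC
        tracial_stateD(2)[OF \<tau>])
  have "\<tau> (E (x * y)) = \<tau> (E (re_part x * y)) + \<i> * \<tau> (E (im_part x * y))"
    by (subst re_im_part[of x, symmetric])
       (simp add: distrib_right mult_scaleC_left E_add E_scaleC tracial_stateD(1,2)[OF \<tau>])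
  also have "\<dots> = \<tau> (E (y * re_part x)) + \<i> * \<tau> (E (y * im_part x))"
    by (simp add: sa)
  also have "\<dots> = \<tau> (E (y * x))"
    by (subst (3) re_im_part[of x, symmetric])
       (simp add: distrib_left mult_scaleC_right E_add E_scaleC tracial_stateD(1,2)[OF \<tau>])
  finally show ?thesis .
qed

section \<open>The sign and the pullback of traces\<close>

text \<open>The group of \<open>S 1\<close> is scalar, so \<open>S 1\<close> is a real scalar
  \<open>r\<close>. Periodicity makes \<open>r\<close> an integer, contractivity bounds it by 1 in
  absolute value, and injectivity excludes 0.\<close>

lemma S_one:
  assumes circle: "\<theta> ` scalar_circle \<subseteq> scalar_circle" and inj: "inj_on \<theta> U0"
  obtains "S 1 = 1" | "S 1 = - 1"
proof -
  let ?Z = "range (\<lambda>z. z *\<^sub>C (1::'b))"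
  \<comment> \<open>The scalars are an isometric copy of the complex numbers, hence closed, so the
    derivative of a scalar curve is scalar.\<close>
  have "complete ?Z"
    by (rule complete_isometric_image[of 1 UNIV])
       (auto simp: bounded_linear_scaleC_one complete_UNIV)
  then have Z: "closed ?Z" by (rule complete_imp_closed)
  let ?v = "\<lambda>t. exp (t *\<^sub>R two_pi_i (S 1))"
  have "?v t \<in> ?Z" for t
  proof -
    have "exp (t *\<^sub>R two_pi_i (1 *\<^sub>C (1::'a))) \<in> scalar_circle"
      unfolding exp_two_pi_i_scaleC_one scalar_circle_def by (intro imageI) simp
    then have "\<theta> (exp (t *\<^sub>R two_pi_i 1)) \<in> scalar_circle" using circle by auto
    then show ?thesis by (auto simp: hom_exp scalar_circle_def)
  qed
  then have v: "\<exists>z. ?v t = z *\<^sub>C 1" for t by blast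
  have "(?v t - ?v 0) /\<^sub>R t \<in> ?Z" for t
  proof -
    obtain z where "?v t = z *\<^sub>C 1" using v by blast
    then have "(?v t - ?v 0) /\<^sub>R t = (of_real (inverse t) * (z - 1)) *\<^sub>C 1"
      unfolding scaleR_scaleC[symmetric] by (simp add: scaleC_diff_left)
    then show ?thesis by blast
  qed
  moreover have "((\<lambda>t. (?v t - ?v 0) /\<^sub>R t) \<longlongrightarrow> two_pi_i (S 1)) (at 0)"
    using tendsto_difference_quotient_at_0[OF exp_derivative_0] by simp
  ultimately have "two_pi_i (S 1) \<in> ?Z"
    by (intro Lim_in_closed_set[OF Z]) auto
  then obtain w where "two_pi_i (S 1) = w *\<^sub>C 1" by blast
  then have "S 1 = (1 / (2 * pi * \<i>) * w) *\<^sub>C 1"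
    by (metis two_pi_i_scaleC_inverse(2) scaleC_scaleC)
  then obtain z where z: "S 1 = z *\<^sub>C 1" by blast
  have "cnj z = z"
    using adj_S[of 1] by (simp add: z adj_scaleC)
  then have zr: "z = of_real (Re z)"
    by (metis Reals_cnj_iff of_real_Re)
  define r where "r = Re z"
  have S1: "S 1 = of_real r *\<^sub>C 1" using z zr by (simp add: r_def)
  have hom: "\<theta> (exp (2 * pi * \<i> * t) *\<^sub>C 1) = exp (2 * pi * \<i> * t * r) *\<^sub>C 1" for t :: real
    using hom_exp[of 1 t] exp_two_pi_i_scaleC_one[of t 1, where 'a = 'a]
      exp_two_pi_i_scaleC_one[of t "of_real r", where 'a = 'b]
    by (simp add: S1)
  have "\<bar>r\<bar> \<le> 1" using norm_S_le[of 1] by (simp add: S1)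
  have "exp (2 * pi * \<i> * r) *\<^sub>C (1::'b) = 1 *\<^sub>C 1"
    using hom[of 1] by (simp add: exp_two_pi_i' hom_one mult_ac)
  then have "exp (2 * pi * \<i> * r) = 1" by (simp only: scaleC_one_inject)
  then obtain n :: int where n: "r = n"
    by (auto simp: exp_eq_1)
  \<comment> \<open>For \<open>r = 0\<close> the whole circle is sent to 1; parameter 1/2 shows this
    for -1, contradicting injectivity.\<close>
  have "r \<noteq> 0"
  proof
    assume "r = 0"
    then have "\<theta> ((- 1) *\<^sub>C 1) = \<theta> 1"
      using hom[of "1/2"] by (simp add: hom_one)
    moreover have "(- 1) *\<^sub>C (1::'a) \<in> U0"
      using exp_two_pi_i_in_U0[of 1 "1/2"] exp_two_pi_i_scaleC_one[of "1/2" 1, where 'a = 'a] by simp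
    ultimately have "(- 1) *\<^sub>C (1::'a) = 1 *\<^sub>C 1"
      using inj one_in_U0 by (auto dest: inj_onD)
    then show False by (simp only: scaleC_one_inject) simp
  qed
  then have "r = 1 \<or> r = - 1"
    using n \<open>\<bar>r\<bar> \<le> 1\<close> by (cases "n \<ge> 1"; cases "n \<le> - 1") auto
  then show thesis using S1 that by (auto simp: scaleC_minus_left)
qed

text \<open>The factor \<open>s\<close> makes the functional unital because
  \<open>s * s = 1\<close>, and contractivity of \<open>S\<close> supplies the norm bound of the
  criterion.\<close>

lemma pullback_tracial_state:
  fixes s :: real and \<tau> :: "'b \<Rightarrow> complex"
  assumes \<tau>: "\<tau> \<in> tracial_states" and s: "\<bar>s\<bar> = 1" "S 1 = s *\<^sub>R 1"
  shows "(\<lambda>x. s * \<tau> (E x)) \<in> tracial_states"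
proof (rule tracial_state_of_norm_le)
  show "bounded_linear (\<lambda>x. s * \<tau> (E x))"
    by (intro bounded_linear_const_mult bounded_linear_compose[OF bounded_linear_tracial_state[OF \<tau>]
          bounded_linear_E])
  show "s * \<tau> (E (c *\<^sub>C x)) = c * (s * \<tau> (E x))" for c x
    by (simp add: E_scaleC tracial_stateD(2)[OF \<tau>])
  show "s * \<tau> (E (x * y)) = s * \<tau> (E (y * x))" for x y
    by (simp add: tracial_state_E_commute[OF \<tau>])
  have "s * s = 1" using s(1) by (auto simp: abs_if split: if_splits)
  then show "s * \<tau> (E 1) = 1"
    by (simp add: E_self_adjoint s(2) tracial_state_scaleR[OF \<tau>] tracial_stateD(4)[OF \<tau>]
        flip: of_real_mult)
  fix a :: 'a assume a: "adj a = a"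
  show "Im (s * \<tau> (E a)) = 0"
    by (simp add: E_self_adjoint a tracial_state_real[OF \<tau>] adj_S)
  have "\<bar>Re (s * \<tau> (E a))\<bar> = \<bar>Re (\<tau> (S a))\<bar>"
    using s(1) by (simp add: E_self_adjoint a abs_mult)
  also have "\<dots> \<le> norm a"
    using tracial_state_le_norm[OF \<tau> adj_S[OF a]] norm_S_le[OF a] by simp
  finally show "Re (s * \<tau> (E a)) \<le> norm a" by simp
qed

end

section \<open>The affine map between the trace spaces\<close>

theorem theorem4p6:
  fixes \<theta> :: "'a::unital_cstar_algebra \<Rightarrow> 'b::unital_cstar_algebra"
  assumes "\<theta> ` U0 \<subseteq> U0"
    and "\<And>u v. u \<in> U0 \<Longrightarrow> v \<in> U0 \<Longrightarrow> \<theta> (u * v) = \<theta> u * \<theta> v"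
    and "\<And>u v. u \<in> U0 \<Longrightarrow> v \<in> U0 \<Longrightarrow> norm (\<theta> u - \<theta> v) \<le> norm (u - v)"
    and "inj_on \<theta> U0"
    and "\<theta> ` scalar_circle = scalar_circle"
    and "(tracial_states :: ('a \<Rightarrow> complex) set) \<noteq> {}"
  shows "(positive_AffT (Lambda_map \<theta>) \<or> positive_AffT (\<lambda>f \<tau>. - Lambda_map \<theta> f \<tau>)) \<and>
    (\<exists>T :: ('b \<Rightarrow> complex) \<Rightarrow> ('a \<Rightarrow> complex).
       T ` tracial_states \<subseteq> tracial_states \<and>
       continuous_on tracial_states T \<and>
       affine_map_T T \<and>
       (positive_AffT (Lambda_map \<theta>) \<longrightarrow>
          (\<forall>f\<in>AffT. \<forall>\<tau>\<in>tracial_states. Lambda_map \<theta> f \<tau> = f (T \<tau>))) \<and>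
       (positive_AffT (\<lambda>f \<tau>. - Lambda_map \<theta> f \<tau>) \<longrightarrow>
          (\<forall>f\<in>AffT. \<forall>\<tau>\<in>tracial_states. - Lambda_map \<theta> f \<tau> = f (T \<tau>))))"
proof -
  interpret contractive_unitary_hom \<theta>
    using assms(1-3) by unfold_locales auto
  obtain s :: real where s: "s = 1 \<or> s = - 1" "S 1 = s *\<^sub>R 1"
    using S_one[of thesis] assms(4,5) by force
  then have abs_s: "\<bar>s\<bar> = 1" and ss: "s * s = 1" by auto
  define T where "T \<tau> = (\<lambda>x. s * \<tau> (E x))" for \<tau> :: "'b \<Rightarrow> complex"
  have T: "T ` tracial_states \<subseteq> tracial_states"
    using pullback_tracial_state[OF _ abs_s s(2)] by (auto simp: T_def)
  have cont: "continuous_on tracial_states T"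
    unfolding T_def by (intro continuous_on_coordinatewise_then_product continuous_intros continuous_on_eval)
  have aff: "affine_map_T T"
    by (simp add: affine_map_T_def T_def convex_comb_def algebra_simps)
  \<comment> \<open>Since \<open>s\<close> is its own inverse, \<open>\<tau> \<circ> S\<close> is
    \<open>s\<close> times \<open>T \<tau>\<close> on self-adjoint elements.\<close>
  have Lam: "Lambda_map \<theta> f \<tau> = s * f (T \<tau>)" if "f \<in> AffT" "\<tau> \<in> tracial_states" for f \<tau>
  proof (rule Lambda_map_eq[OF T cont aff _ that])
    fix a :: 'a and \<tau> :: "'b \<Rightarrow> complex" assume "a \<in> self_adjoint"
    then show "Re (\<tau> (S a)) = s * Re (T \<tau> a)"
      using ss by (simp add: T_def E_self_adjoint self_adjoint_def flip: mult.assoc)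
  qed
  have Tin: "T \<tau> \<in> tracial_states" if "\<tau> \<in> tracial_states" for \<tau>
    using T that by auto
  have pos: "positive_AffT (\<lambda>f \<tau>. s * Lambda_map \<theta> f \<tau>)"
    unfolding positive_AffT_def using Lam Tin ss by (simp flip: mult.assoc)
  text \<open>If both signs of \<open>\<Lambda>\<close> were positive, evaluation at the constant function \<open>1\<close> would leave
    no tracial state on the codomain.\<close>
  have sign: "r = s" if r: "r = 1 \<or> r = - 1" "positive_AffT (\<lambda>f \<tau>. r * Lambda_map \<theta> f \<tau>)"
    and \<tau>: "\<tau> \<in> tracial_states" for r and \<tau> :: "'b \<Rightarrow> complex"
  proof -
    have "0 \<le> r * Lambda_map \<theta> (hat 1) \<tau>"
      using r(2) \<tau> hat_in_AffT[of 1] unfolding positive_AffT_def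
      by (auto simp: hat_def tracial_stateD(4))
    also have "Lambda_map \<theta> (hat 1) \<tau> = s"
      using Lam[OF hat_in_AffT \<tau>, of 1] Tin[OF \<tau>] by (simp add: hat_def tracial_stateD(4))
    finally show ?thesis using r(1) s(1) by auto
  qed
  \<comment> \<open>A tracial state on the codomain pins the positive sign to \<open>s\<close>; if
    there is none, the formula is vacuous for both signs.\<close>
  have formula: "r * Lambda_map \<theta> f \<tau> = f (T \<tau>)"
    if "r = 1 \<or> r = - 1" "positive_AffT (\<lambda>f \<tau>. r * Lambda_map \<theta> f \<tau>)" "f \<in> AffT"
      "\<tau> \<in> tracial_states" for r f \<tau>
    using sign[OF that(1,2,4)] Lam[OF that(3,4)] ss by (simp flip: mult.assoc)
  show ?thesis
    using pos s(1) T cont aff formula[of 1] formula[of "- 1"] by (intro conjI exI[of _ T]) auto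
qed

end
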